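(* For any real $p\in[1,\infty)$ and any dimension $n\geq 2$, there exists a complete non-compact $n$-dimensional Riemannian manifold $(M,g)$ such that the set $H^{2,p}(M)\setminus W^{2,p}(M)$ is non-empty.
   Context: Riemannian manifolds $(M,g)$ are smooth and without boundary; $\nabla$ denotes the Levi-Civita covariant derivative, and $\Delta$ the Laplace-Beltrami operator of $(M,g)$ (with the sign convention giving negative spectrum). $L^p$ norms are taken with respect to the Riemannian measure $\mu_g$. The Sobolev space $W^{2,p}(M)$ is the space of functions $u$ on $M$ all of whose (distributional) covariant derivatives $\nabla^j u$ of order $j$ are tensor fields with finite $L^p$-norm, for $0\leq j\leq 2$. The space $H^{2,p}(M)$ is defined by $$H^{2,p}(M)=\{u\in L^p(M) : (1-\Delta)u\in L^p(M)\},$$ where derivatives are interpreted in the distributional sense. *)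

theory Defs
  imports "HOL-Analysis.Analysis"
begin

section \<open>Smooth functions on open subsets of Euclidean space\<close>

definition pd :: "'n::finite \<Rightarrow> (real^'n \<Rightarrow> 'b::real_normed_vector) \<Rightarrow> real^'n \<Rightarrow> 'b" where
  "pd i f y = frechet_derivative f (at y) (axis i 1)"

text \<open>Used for open \<open>S\<close> only: all iterated partial derivatives exist and are differentiable,
  which is the usual \<open>C\<^sup>\<infinity>\<close> condition.\<close>

definition smooth_on :: "(real^'n) set \<Rightarrow> (real^'n \<Rightarrow> 'b::real_normed_vector) \<Rightarrow> bool" where
  "smooth_on S f \<longleftrightarrow> (\<forall>is. foldr pd is f differentiable_on S)"


section \<open>Riemannian manifolds\<close>

text \<open>A chart is a pair of its domain and its coordinate map (whose values outside the domain are
  irrelevant).\<close>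

type_synonym ('a, 'n) chart = "'a set \<times> ('a \<Rightarrow> real^'n)"

definition chart_image :: "('a, 'n::finite) chart \<Rightarrow> (real^'n) set" where
  "chart_image c = snd c ` fst c"

definition chart_inv :: "('a, 'n::finite) chart \<Rightarrow> real^'n \<Rightarrow> 'a" where
  "chart_inv c = inv_into (fst c) (snd c)"

definition transition :: "('a, 'n::finite) chart \<Rightarrow> ('a, 'n) chart \<Rightarrow> real^'n \<Rightarrow> real^'n" where
  "transition c d = snd d \<circ> chart_inv c"

definition overlap :: "('a, 'n::finite) chart \<Rightarrow> ('a, 'n) chart \<Rightarrow> (real^'n) set" where
  "overlap c d = snd c ` (fst c \<inter> fst d)"

definition jacobian :: "('a, 'n::finite) chart \<Rightarrow> ('a, 'n) chart \<Rightarrow> real^'n \<Rightarrow> real^'n^'n" where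
  "jacobian c d y = (\<chi> k i. pd i (transition c d) y $ k)"

text \<open>The metric is given by its coefficient matrix \<open>(g\<^sub>i\<^sub>j)\<close> in every chart of the atlas, as a
  function of the coordinates. The atlas need not be maximal. The topology on the point type is
  arbitrary: since a second countable manifold of positive dimension \<open>n\<close> has as many points as
  the continuum, every such manifold has an isometric copy whose points are of type \<open>real^'n\<close>,
  with a topology and charts that need not be related to the Euclidean ones.\<close>

record ('a, 'n) riem =
  mtop :: "'a topology"
  atlas :: "('a, 'n::finite) chart set"
  metric :: "('a, 'n) chart \<Rightarrow> real^'n \<Rightarrow> real^'n^'n"

definition is_chart :: "'a topology \<Rightarrow> ('a, 'n::finite) chart \<Rightarrow> bool" where
  "is_chart X c \<longleftrightarrow> openin X (fst c) \<and> open (chart_image c) \<and>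
     homeomorphic_map (subtopology X (fst c)) (top_of_set (chart_image c)) (snd c)"

definition smooth_atlas :: "'a topology \<Rightarrow> ('a, 'n::finite) chart set \<Rightarrow> bool" where
  "smooth_atlas X A \<longleftrightarrow>
     (\<forall>c\<in>A. is_chart X c) \<and> (\<Union>c\<in>A. fst c) = topspace X \<and>
     (\<forall>c\<in>A. \<forall>d\<in>A. smooth_on (overlap c d) (transition c d))"

definition riemannian_metric ::
    "('a, 'n::finite) chart set \<Rightarrow> (('a, 'n) chart \<Rightarrow> real^'n \<Rightarrow> real^'n^'n) \<Rightarrow> bool" where
  "riemannian_metric A g \<longleftrightarrow>
     (\<forall>c\<in>A. smooth_on (chart_image c) (g c) \<and>
       (\<forall>y\<in>chart_image c. transpose (g c y) = g c y \<and> (\<forall>v. v \<noteq> 0 \<longrightarrow> 0 < v \<bullet> (g c y *v v)))) \<and>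
     (\<forall>c\<in>A. \<forall>d\<in>A. \<forall>y\<in>overlap c d.
       g c y = transpose (jacobian c d y) ** g d (transition c d y) ** jacobian c d y)"

definition riemannian_manifold :: "('a, 'n::finite) riem \<Rightarrow> bool" where
  "riemannian_manifold M \<longleftrightarrow>
     Hausdorff_space (mtop M) \<and> second_countable (mtop M) \<and> connected_space (mtop M) \<and>
     smooth_atlas (mtop M) (atlas M) \<and> riemannian_metric (atlas M) (metric M)"

text \<open>Pointwise quantities that do not depend on the chart are evaluated in an arbitrary chart
  around the point.\<close>

definition chart_at :: "('a, 'n::finite) riem \<Rightarrow> 'a \<Rightarrow> ('a, 'n) chart" where
  "chart_at M x = (SOME c. c \<in> atlas M \<and> x \<in> fst c)"


section \<open>Riemannian distance and completeness\<close>

definition piecewise_C1_curve :: "('a, 'n::finite) riem \<Rightarrow> (real \<Rightarrow> 'a) \<Rightarrow> bool" where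
  "piecewise_C1_curve M \<gamma> \<longleftrightarrow>
     continuous_map (top_of_set {0..1}) (mtop M) \<gamma> \<and>
     (\<exists>S. finite S \<and> (\<forall>c\<in>atlas M.
        (snd c \<circ> \<gamma>) C1_differentiable_on {t \<in> {0<..<1} - S. \<gamma> t \<in> fst c}))"

definition speed :: "('a, 'n::finite) riem \<Rightarrow> (real \<Rightarrow> 'a) \<Rightarrow> real \<Rightarrow> real" where
  "speed M \<gamma> t =
     (let c = chart_at M (\<gamma> t); v = vector_derivative (snd c \<circ> \<gamma>) (at t)
      in sqrt (v \<bullet> (metric M c (snd c (\<gamma> t)) *v v)))"

definition curve_length :: "('a, 'n::finite) riem \<Rightarrow> (real \<Rightarrow> 'a) \<Rightarrow> ennreal" where
  "curve_length M \<gamma> = (\<integral>\<^sup>+t\<in>{0..1}. ennreal (speed M \<gamma> t) \<partial>lborel)"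

definition riem_dist :: "('a, 'n::finite) riem \<Rightarrow> 'a \<Rightarrow> 'a \<Rightarrow> ennreal" where
  "riem_dist M x y =
     (INF \<gamma>\<in>{\<gamma>. piecewise_C1_curve M \<gamma> \<and> \<gamma> 0 = x \<and> \<gamma> 1 = y}. curve_length M \<gamma>)"

definition riem_complete :: "('a, 'n::finite) riem \<Rightarrow> bool" where
  "riem_complete M \<longleftrightarrow>
     (\<forall>\<sigma>. range \<sigma> \<subseteq> topspace (mtop M) \<and>
          (\<forall>e>0. \<exists>N. \<forall>m\<ge>N. \<forall>n\<ge>N. riem_dist M (\<sigma> m) (\<sigma> n) < ennreal e)
        \<longrightarrow> (\<exists>x\<in>topspace (mtop M). (\<lambda>n. riem_dist M (\<sigma> n) x) \<longlonglongrightarrow> 0))"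


section \<open>Riemannian measure and Lebesgue spaces\<close>

text \<open>The unique Borel measure with \<open>d\<mu> = sqrt (det g) dy\<close> in every chart.\<close>

definition riem_measure :: "('a, 'n::finite) riem \<Rightarrow> 'a measure" where
  "riem_measure M = (THE \<mu>.
     space \<mu> = topspace (mtop M) \<and>
     sets \<mu> = sigma_sets (topspace (mtop M)) {U. openin (mtop M) U} \<and>
     (\<forall>c\<in>atlas M. \<forall>B\<in>sets \<mu>. B \<subseteq> fst c \<longrightarrow>
        emeasure \<mu> B = (\<integral>\<^sup>+y\<in>snd c ` B. ennreal (sqrt (det (metric M c y))) \<partial>lborel)))"

definition Lp :: "real \<Rightarrow> ('a, 'n::finite) riem \<Rightarrow> ('a \<Rightarrow> real) set" where
  "Lp p M = {u \<in> borel_measurable (riem_measure M).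
     integrable (riem_measure M) (\<lambda>x. \<bar>u x\<bar> powr p)}"


section \<open>Tensor fields and the Levi-Civita connection\<close>

text \<open>Covariant tensor fields of rank one and two, not necessarily continuous, are given by their
  components in every chart, subject to the tensorial transformation law.\<close>

definition covector_field ::
    "('a, 'n::finite) riem \<Rightarrow> (('a, 'n) chart \<Rightarrow> real^'n \<Rightarrow> real^'n) \<Rightarrow> bool" where
  "covector_field M \<omega> \<longleftrightarrow> (\<forall>c\<in>atlas M. \<forall>d\<in>atlas M. \<forall>y\<in>overlap c d.
     \<omega> c y = transpose (jacobian c d y) *v \<omega> d (transition c d y))"

definition tensor2_field ::
    "('a, 'n::finite) riem \<Rightarrow> (('a, 'n) chart \<Rightarrow> real^'n \<Rightarrow> real^'n^'n) \<Rightarrow> bool" where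
  "tensor2_field M h \<longleftrightarrow> (\<forall>c\<in>atlas M. \<forall>d\<in>atlas M. \<forall>y\<in>overlap c d.
     h c y = transpose (jacobian c d y) ** h d (transition c d y) ** jacobian c d y)"

definition covector_norm ::
    "('a, 'n::finite) riem \<Rightarrow> (('a, 'n) chart \<Rightarrow> real^'n \<Rightarrow> real^'n) \<Rightarrow> 'a \<Rightarrow> real" where
  "covector_norm M \<omega> x =
     (let c = chart_at M x; y = snd c x; G = matrix_inv (metric M c y)
      in sqrt (\<Sum>i\<in>UNIV. \<Sum>j\<in>UNIV. G $ i $ j * \<omega> c y $ i * \<omega> c y $ j))"

definition tensor2_norm ::
    "('a, 'n::finite) riem \<Rightarrow> (('a, 'n) chart \<Rightarrow> real^'n \<Rightarrow> real^'n^'n) \<Rightarrow> 'a \<Rightarrow> real" where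
  "tensor2_norm M h x =
     (let c = chart_at M x; y = snd c x; G = matrix_inv (metric M c y)
      in sqrt (\<Sum>i\<in>UNIV. \<Sum>j\<in>UNIV. \<Sum>k\<in>UNIV. \<Sum>l\<in>UNIV.
                 G $ i $ k * G $ j $ l * h c y $ i $ j * h c y $ k $ l))"

text \<open>\<open>christoffel g k i j\<close> is the Christoffel symbol with upper index \<open>k\<close> and lower
  indices \<open>i\<close>, \<open>j\<close> of a metric \<open>g\<close> on an open subset of Euclidean space.\<close>

definition christoffel ::
    "(real^'n \<Rightarrow> real^'n^'n) \<Rightarrow> 'n::finite \<Rightarrow> 'n \<Rightarrow> 'n \<Rightarrow> real^'n \<Rightarrow> real" where
  "christoffel g k i j y = (1/2) * (\<Sum>l\<in>UNIV. matrix_inv (g y) $ k $ l *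
     (pd i (\<lambda>z. g z $ j $ l) y + pd j (\<lambda>z. g z $ i $ l) y - pd l (\<lambda>z. g z $ i $ j) y))"


section \<open>Distributional derivatives and the spaces \<open>W\<^sup>2\<^sup>,\<^sup>p\<close> and \<open>H\<^sup>2\<^sup>,\<^sup>p\<close>\<close>

definition test_fun_on :: "(real^'n) set \<Rightarrow> (real^'n \<Rightarrow> real) \<Rightarrow> bool" where
  "test_fun_on \<Omega> \<phi> \<longleftrightarrow> smooth_on \<Omega> \<phi> \<and>
     (\<exists>K. compact K \<and> K \<subseteq> \<Omega> \<and> (\<forall>y\<in>\<Omega> - K. \<phi> y = 0))"

definition locally_integrable :: "(real^'n) set \<Rightarrow> (real^'n \<Rightarrow> real) \<Rightarrow> bool" where
  "locally_integrable \<Omega> f \<longleftrightarrow>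
     (\<forall>K. compact K \<and> K \<subseteq> \<Omega> \<longrightarrow> set_integrable lborel K f)"

definition weak_pd ::
    "(real^'n) set \<Rightarrow> 'n::finite \<Rightarrow> (real^'n \<Rightarrow> real) \<Rightarrow> (real^'n \<Rightarrow> real) \<Rightarrow> bool" where
  "weak_pd \<Omega> i f f' \<longleftrightarrow> locally_integrable \<Omega> f \<and> locally_integrable \<Omega> f' \<and>
     (\<forall>\<phi>. test_fun_on \<Omega> \<phi> \<longrightarrow>
        (LINT y:\<Omega>|lborel. f y * pd i \<phi> y) = - (LINT y:\<Omega>|lborel. f' y * \<phi> y))"

definition weak_gradient :: "('a, 'n::finite) riem \<Rightarrow> ('a \<Rightarrow> real) \<Rightarrow>
    (('a, 'n) chart \<Rightarrow> real^'n \<Rightarrow> real^'n) \<Rightarrow> bool" where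
  "weak_gradient M u \<omega> \<longleftrightarrow> covector_field M \<omega> \<and>
     (\<forall>c\<in>atlas M. \<forall>i. weak_pd (chart_image c) i (u \<circ> chart_inv c) (\<lambda>y. \<omega> c y $ i))"

text \<open>\<open>h = \<nabla>\<omega>\<close>, that is, \<open>h\<^sub>i\<^sub>j = \<partial>\<^sub>i \<omega>\<^sub>j - \<Sum>\<^sub>k \<Gamma>\<^sup>k\<^sub>i\<^sub>j \<omega>\<^sub>k\<close> in the sense of distributions.\<close>

definition weak_covariant_derivative :: "('a, 'n::finite) riem \<Rightarrow>
    (('a, 'n) chart \<Rightarrow> real^'n \<Rightarrow> real^'n) \<Rightarrow> (('a, 'n) chart \<Rightarrow> real^'n \<Rightarrow> real^'n^'n) \<Rightarrow> bool" where
  "weak_covariant_derivative M \<omega> h \<longleftrightarrow> tensor2_field M h \<and>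
     (\<forall>c\<in>atlas M. \<forall>i j. weak_pd (chart_image c) i (\<lambda>y. \<omega> c y $ j)
        (\<lambda>y. h c y $ i $ j + (\<Sum>k\<in>UNIV. christoffel (metric M c) k i j y * \<omega> c y $ k)))"

definition W2p :: "real \<Rightarrow> ('a, 'n::finite) riem \<Rightarrow> ('a \<Rightarrow> real) set" where
  "W2p p M = {u \<in> Lp p M. \<exists>\<omega> h.
     weak_gradient M u \<omega> \<and> covector_norm M \<omega> \<in> Lp p M \<and>
     weak_covariant_derivative M \<omega> h \<and> tensor2_norm M h \<in> Lp p M}"

text \<open>The Laplace-Beltrami operator \<open>div grad\<close>, first in coordinates.\<close>

definition laplace_coord ::
    "(real^'n \<Rightarrow> real^'n^'n) \<Rightarrow> (real^'n \<Rightarrow> real) \<Rightarrow> real^'n::finite \<Rightarrow> real" where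
  "laplace_coord g v y = 1 / sqrt (det (g y)) *
     (\<Sum>i\<in>UNIV. pd i (\<lambda>z. sqrt (det (g z)) *
        (\<Sum>j\<in>UNIV. matrix_inv (g z) $ i $ j * pd j v z)) y)"

definition laplace_beltrami :: "('a, 'n::finite) riem \<Rightarrow> ('a \<Rightarrow> real) \<Rightarrow> 'a \<Rightarrow> real" where
  "laplace_beltrami M \<phi> x =
     (let c = chart_at M x in laplace_coord (metric M c) (\<phi> \<circ> chart_inv c) (snd c x))"

definition test_fun :: "('a, 'n::finite) riem \<Rightarrow> ('a \<Rightarrow> real) \<Rightarrow> bool" where
  "test_fun M \<phi> \<longleftrightarrow> (\<forall>c\<in>atlas M. smooth_on (chart_image c) (\<phi> \<circ> chart_inv c)) \<and>
     (\<exists>K. compactin (mtop M) K \<and> (\<forall>x\<in>topspace (mtop M) - K. \<phi> x = 0))"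

text \<open>\<open>f = (1 - \<Delta>) u\<close> in the sense of distributions; \<open>\<Delta>\<close> is formally self-adjoint with
  respect to the Riemannian measure.\<close>

definition weak_one_minus_laplace ::
    "('a, 'n::finite) riem \<Rightarrow> ('a \<Rightarrow> real) \<Rightarrow> ('a \<Rightarrow> real) \<Rightarrow> bool" where
  "weak_one_minus_laplace M u f \<longleftrightarrow> (\<forall>\<phi>. test_fun M \<phi> \<longrightarrow>
     (\<integral>x. u x * (\<phi> x - laplace_beltrami M \<phi> x) \<partial>riem_measure M)
       = (\<integral>x. f x * \<phi> x \<partial>riem_measure M))"

definition H2p :: "real \<Rightarrow> ('a, 'n::finite) riem \<Rightarrow> ('a \<Rightarrow> real) set" where
  "H2p p M = {u \<in> Lp p M. \<exists>f\<in>Lp p M. weak_one_minus_laplace M u f}"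

end

theory Submission
  imports Defs "HOL-Probability.Distributions"
begin

text \<open>Take \<open>M = \<real>\<^sup>n\<close> with the product of the conformally flat plane
  \<open>\<lambda> (dx\<^sub>a\<^sup>2 + dx\<^sub>b\<^sup>2)\<close> and flat space, where \<open>\<lambda> = exp (1 + sin \<theta>)\<close> and
  \<open>\<theta> = exp (2 x\<^sub>a\<^sup>2)\<close>. Since \<open>1 \<le> \<lambda> \<le> exp 2\<close>, the metric is uniformly equivalent to the Euclidean
  one, hence complete. The Laplacian of this metric contains no derivative of \<open>\<lambda>\<close>, so for the
  Gaussian \<open>u = exp (- |x|\<^sup>2)\<close> both \<open>u\<close> and \<open>\<Delta>u\<close> decay like Gaussians. The Hessian, however,
  contains the Christoffel symbols: its \<open>aa\<close>-component is
  \<open>u (4 x\<^sub>a\<^sup>2 - 2 + x\<^sub>a \<theta>' cos \<theta>)\<close>, and \<open>\<theta>'\<close> grows faster than \<open>u\<close> decays. Testing against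
  \<open>cos \<theta> / u\<close> times a unit bump moving to infinity in the direction of \<open>x\<^sub>a\<close> shows that it is not
  in \<open>L\<^sup>p\<close>.\<close>

section \<open>Smooth functions\<close>

text \<open>The Hessian sees first derivatives of the metric, while the Laplacian of a function need
  not: scaling the metric of a surface by \<lambda> only divides its Laplacian by \<lambda>, and
  flat factors preserve the absence of derivatives because \<lambda> depends on x_a alone. So
  \<lambda> may oscillate ever faster at infinity as long as it stays bounded, hence a sine of an
  exponential. The rate 2 in \<theta> is tied to the Gaussian: near distance k, dividing by u costs
  about exp (k^2), whereas \<theta> gains about exp (2 k^2). One obstacle is that the Hessian
  changes sign just as rapidly, so that a bump of fixed sign could average it out; the factor cos
  \<theta> in the test function turns the oscillation into cos^2 \<theta>, of mean 1/2. The other is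
  that membership in \<open>W2p\<close> supplies only some tensor field tied to u by integral
  identities. Integrals against test functions are exactly what these identities evaluate, and an
  L^p bound limits them by a fixed multiple of the supremum of the test function, since all bumps
  have unit size.\<close>

lemma pd_eq:
  assumes "(f has_derivative D) (at x)"
  shows "pd i f x = D (axis i 1)"
  using frechet_derivative_at[OF assms] by (simp add: pd_def)

text \<open>Smoothness is the largest property that implies differentiability and is preserved by
  \<open>pd\<close>. Exhibiting one such class \<open>A\<close> avoids formulas for iterated partial
  derivatives of every order.\<close>

lemma smooth_on_coinduct:
  fixes f :: "real^'n \<Rightarrow> 'b::real_normed_vector"
  assumes "f \<in> A"
    and "\<And>h. h \<in> A \<Longrightarrow> h differentiable_on S"
    and "\<And>h i. h \<in> A \<Longrightarrow> pd i h \<in> A"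
  shows "smooth_on S f"
proof -
  have "foldr pd is f \<in> A" for "is"
    by (induction "is") (use assms in auto)
  then show ?thesis
    using assms(2) by (auto simp: smooth_on_def)
qed

lemma smooth_on_pd: "smooth_on S f \<Longrightarrow> smooth_on S (pd i f)"
  unfolding smooth_on_def
proof
  fix "is"
  assume "\<forall>is. foldr pd is f differentiable_on S"
  then have "foldr pd (is @ [i]) f differentiable_on S" by blast
  then show "foldr pd is (pd i f) differentiable_on S" by simp
qed

lemma smooth_on_differentiable: "smooth_on S f \<Longrightarrow> f differentiable_on S"
  unfolding smooth_on_def by (metis foldr_Nil id_apply)

lemma smooth_has_derivative:
  assumes "smooth_on UNIV f"
  shows "(f has_derivative frechet_derivative f (at x)) (at x)"
  using smooth_on_differentiable[OF assms] frechet_derivative_works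
  by (auto simp: differentiable_on_def)

lemma smooth_continuous_on: "smooth_on UNIV f \<Longrightarrow> continuous_on T f"
  using smooth_on_differentiable[of UNIV f] differentiable_imp_continuous_on continuous_on_subset
  by blast

lemma smooth_borel_measurable: "smooth_on UNIV f \<Longrightarrow> f \<in> borel_measurable borel"
  by (intro borel_measurable_continuous_onI smooth_continuous_on)

text \<open>With the whole sequence of derivatives as witness, a composition with \<open>D m\<close>
  differentiates into one with \<open>D (Suc m)\<close> and so stays within a single class of
  expressions.\<close>

definition smooth_real :: "(real \<Rightarrow> real) \<Rightarrow> bool" where
  "smooth_real F \<longleftrightarrow>
     (\<exists>D. D 0 = F \<and> (\<forall>m t. (D m has_real_derivative D (Suc m) t) (at t)))"

text \<open>Smoothness bounds no order of differentiation, so its closure properties are not proved one at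
  a time: all these expressions together form a class that is closed under partial derivatives.\<close>

inductive smooth_expr :: "(real^'n::finite \<Rightarrow> real) \<Rightarrow> bool" where
  base: "smooth_on UNIV f \<Longrightarrow> smooth_expr f"
| add: "smooth_expr f \<Longrightarrow> smooth_expr h \<Longrightarrow> smooth_expr (\<lambda>x. f x + h x)"
| mult: "smooth_expr f \<Longrightarrow> smooth_expr h \<Longrightarrow> smooth_expr (\<lambda>x. f x * h x)"
| comp: "\<forall>m t. (D m has_real_derivative D (Suc m) t) (at t) \<Longrightarrow> smooth_expr f \<Longrightarrow>
    smooth_expr (\<lambda>x. D m (f x))"

lemma has_derivative_pd_ex:
  assumes "\<And>x. (f has_derivative D x) (at x)"
  shows "pd i f = (\<lambda>x. D x (axis i 1))"
  using pd_eq[OF assms] by auto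

text \<open>The two claims need a joint induction: the product and chain rules require
  differentiability of the subexpressions, and their results are again sums, products and
  compositions.\<close>

lemma smooth_expr_pd:
  assumes "smooth_expr f"
  shows "f differentiable_on UNIV \<and> smooth_expr (pd i f)"
  using assms
proof induction
  case (base f)
  then show ?case
    by (simp add: smooth_on_differentiable smooth_on_pd smooth_expr.base)
next
  case (add f h)
  then have "(f has_derivative frechet_derivative f (at x)) (at x)"
    "(h has_derivative frechet_derivative h (at x)) (at x)" for x
    using frechet_derivative_works by (auto simp: differentiable_on_def)
  then have *: "((\<lambda>x. f x + h x) has_derivative
      (\<lambda>v. frechet_derivative f (at x) v + frechet_derivative h (at x) v)) (at x)" for x
    by (intro derivative_intros)
  have "pd i (\<lambda>x. f x + h x) = (\<lambda>x. pd i f x + pd i h x)"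
    unfolding has_derivative_pd_ex[OF *] by (simp add: pd_def)
  then show ?case
    using add * smooth_expr.add by (auto simp: differentiable_on_def differentiable_def)
next
  case (mult f h)
  then have "(f has_derivative frechet_derivative f (at x)) (at x)"
    "(h has_derivative frechet_derivative h (at x)) (at x)" for x
    using frechet_derivative_works by (auto simp: differentiable_on_def)
  then have *: "((\<lambda>x. f x * h x) has_derivative
      (\<lambda>v. f x * frechet_derivative h (at x) v + frechet_derivative f (at x) v * h x)) (at x)" for x
    by (intro derivative_intros)
  have "pd i (\<lambda>x. f x * h x) = (\<lambda>x. f x * pd i h x + pd i f x * h x)"
    unfolding has_derivative_pd_ex[OF *] by (simp add: pd_def)
  moreover have "smooth_expr (\<lambda>x. f x * pd i h x + pd i f x * h x)"
    using mult by (intro smooth_expr.add smooth_expr.mult) auto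
  ultimately show ?case
    using * by (auto simp: differentiable_on_def differentiable_def)
next
  case (comp D f m)
  then have "(f has_derivative frechet_derivative f (at x)) (at x)" for x
    using frechet_derivative_works[of f "at x"] by (simp add: differentiable_on_def)
  moreover have "(D m has_derivative (\<lambda>v. v * D (Suc m) (f x))) (at (f x))" for x
    using comp(1) by (simp add: has_field_derivative_def mult.commute[of _ "D (Suc m) (f x)"] )
  ultimately have *: "((\<lambda>x. D m (f x)) has_derivative
      (\<lambda>v. frechet_derivative f (at x) v * D (Suc m) (f x))) (at x)" for x
    by (rule has_derivative_compose)
  have "pd i (\<lambda>x. D m (f x)) = (\<lambda>x. pd i f x * D (Suc m) (f x))"
    unfolding has_derivative_pd_ex[OF *] by (simp add: pd_def)
  moreover have "smooth_expr (\<lambda>x. pd i f x * D (Suc m) (f x))"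
    using comp smooth_expr.comp[OF comp(1,2), of "Suc m"] smooth_expr.mult by blast
  ultimately show ?case
    using * by (auto simp: differentiable_on_def differentiable_def)
qed

lemma smooth_exprD: "smooth_expr f \<Longrightarrow> smooth_on UNIV f"
  by (rule smooth_on_coinduct[where A = "Collect smooth_expr"]) (auto simp: smooth_expr_pd)

lemma smooth_add:
  fixes f h :: "real^'n::finite \<Rightarrow> real"
  shows "smooth_on UNIV f \<Longrightarrow> smooth_on UNIV h \<Longrightarrow> smooth_on UNIV (\<lambda>x. f x + h x)"
  by (rule smooth_exprD[OF smooth_expr.add[OF smooth_expr.base smooth_expr.base]])

lemma smooth_mult:
  fixes f h :: "real^'n::finite \<Rightarrow> real"
  shows "smooth_on UNIV f \<Longrightarrow> smooth_on UNIV h \<Longrightarrow> smooth_on UNIV (\<lambda>x. f x * h x)"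
  by (rule smooth_exprD[OF smooth_expr.mult[OF smooth_expr.base smooth_expr.base]])

lemma smooth_compose:
  fixes f :: "real^'n::finite \<Rightarrow> real"
  assumes "smooth_real F" "smooth_on UNIV f"
  shows "smooth_on UNIV (\<lambda>x. F (f x))"
proof -
  obtain D where "D 0 = F" and D: "\<forall>m t. (D m has_real_derivative D (Suc m) t) (at t)"
    using assms(1) by (auto simp: smooth_real_def)
  then show ?thesis
    using smooth_exprD[OF smooth_expr.comp[OF D smooth_expr.base[OF assms(2)], of 0]] by simp
qed

lemma pd_const: "pd i (\<lambda>x. c) = (\<lambda>x. 0)"
  by (auto simp: pd_def)

lemma smooth_const: "smooth_on S (\<lambda>x. c)"
  by (rule smooth_on_coinduct[where A = "range (\<lambda>c x. c)"]) (auto simp: pd_const)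

lemma has_derivative_component:
  "((\<lambda>x :: real^'n::finite. x $ j) has_derivative (\<lambda>v. v $ j)) (at x within S)"
  by (rule bounded_linear_imp_has_derivative) (rule bounded_linear_vec_nth)

lemma pd_component: "pd i (\<lambda>x :: real^'n::finite. x $ j) = (\<lambda>x. if i = j then 1 else 0)"
  using has_derivative_pd_ex[OF has_derivative_component, of i j] by (simp add: axis_def)

lemma smooth_component: "smooth_on S (\<lambda>x :: real^'n::finite. x $ j)"
proof (rule smooth_on_coinduct)
  let ?A = "{(\<lambda>x :: real^'n. x $ j), (\<lambda>x. 1), (\<lambda>x. 0)}"
  show "(\<lambda>x. x $ j) \<in> ?A" by simp
  show "h differentiable_on S" if "h \<in> ?A" for h
  proof -
    have "(\<lambda>x :: real^'n. x $ j) differentiable_on S"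
      using has_derivative_component by (auto simp: differentiable_on_def differentiable_def)
    then show ?thesis using that by auto
  qed
  show "pd i h \<in> ?A" if "h \<in> ?A" for h i
  proof -
    have "pd i (\<lambda>x :: real^'n. x $ j) \<in> ?A"
      unfolding pd_component by (cases "i = j") simp_all
    then show ?thesis using that by (elim insertE) (simp_all add: pd_const)
  qed
qed

lemma smooth_cmult:
  fixes f :: "real^'n::finite \<Rightarrow> real"
  shows "smooth_on UNIV f \<Longrightarrow> smooth_on UNIV (\<lambda>x. c * f x)"
  by (intro smooth_mult smooth_const)

lemma smooth_minus:
  fixes f :: "real^'n::finite \<Rightarrow> real"
  shows "smooth_on UNIV f \<Longrightarrow> smooth_on UNIV (\<lambda>x. - f x)"
  using smooth_cmult[of f "-1"] by simp

lemma smooth_diff: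
  fixes f h :: "real^'n::finite \<Rightarrow> real"
  shows "smooth_on UNIV f \<Longrightarrow> smooth_on UNIV h \<Longrightarrow> smooth_on UNIV (\<lambda>x. f x - h x)"
  using smooth_add[OF _ smooth_minus, of f h] by simp

lemma smooth_power:
  fixes f :: "real^'n::finite \<Rightarrow> real"
  shows "smooth_on UNIV f \<Longrightarrow> smooth_on UNIV (\<lambda>x. f x ^ m)"
  by (induction m) (auto intro: smooth_const smooth_mult)

lemma smooth_sum:
  fixes f :: "'i \<Rightarrow> real^'n::finite \<Rightarrow> real"
  shows "(\<And>i. i \<in> I \<Longrightarrow> smooth_on UNIV (f i)) \<Longrightarrow> smooth_on UNIV (\<lambda>x. \<Sum>i\<in>I. f i x)"
  by (induction I rule: infinite_finite_induct) (auto intro: smooth_const smooth_add)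

lemma smooth_real_exp: "smooth_real exp"
  unfolding smooth_real_def by (intro exI[of _ "\<lambda>_. exp"]) (auto intro: DERIV_exp)

lemma smooth_real_sin: "smooth_real sin"
  unfolding smooth_real_def
\<comment> \<open>Differentiating sin shifts it by a quarter period, so one formula covers all
  orders without a case distinction modulo 4.\<close>
proof (intro exI[of _ "\<lambda>m t. sin (t + real m * (pi/2))"] conjI allI)
  fix m t
  have "((\<lambda>t. sin (t + c)) has_real_derivative cos (t + c)) (at t)" for c :: real
    by (auto intro!: derivative_eq_intros)
  moreover have "sin (s + pi/2) = cos s" for s :: real
    by (simp only: sin_add sin_pi_half cos_pi_half)
  then have "cos (t + real m * (pi/2)) = sin (t + real m * (pi/2) + pi/2)" by simp
  moreover have "t + real m * (pi/2) + pi/2 = t + real (Suc m) * (pi/2)"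
    by (simp only: of_nat_Suc distrib_right mult_1 add.assoc add.commute)
  ultimately show "((\<lambda>t. sin (t + real m * (pi/2))) has_real_derivative
      sin (t + real (Suc m) * (pi/2))) (at t)"
    by metis
qed simp

lemma smooth_exp:
  fixes f :: "real^'n::finite \<Rightarrow> real"
  shows "smooth_on UNIV f \<Longrightarrow> smooth_on UNIV (\<lambda>x. exp (f x))"
  by (rule smooth_compose[OF smooth_real_exp])

lemma smooth_sin:
  fixes f :: "real^'n::finite \<Rightarrow> real"
  shows "smooth_on UNIV f \<Longrightarrow> smooth_on UNIV (\<lambda>x. sin (f x))"
  by (rule smooth_compose[OF smooth_real_sin])

lemma smooth_cos:
  fixes f :: "real^'n::finite \<Rightarrow> real"
  shows "smooth_on UNIV f \<Longrightarrow> smooth_on UNIV (\<lambda>x. cos (f x))"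
  using smooth_sin[OF smooth_diff[OF smooth_const[of UNIV "pi/2"]], of f]
  by (simp add: sin_diff)

lemmas smooth_intros = smooth_const smooth_component smooth_add smooth_diff smooth_minus
  smooth_mult smooth_power smooth_sum smooth_exp smooth_sin smooth_cos smooth_on_pd

section \<open>Calculus rules for partial derivatives\<close>

lemma pd_mult:
  fixes f h :: "real^'n::finite \<Rightarrow> real"
  assumes "smooth_on UNIV f" "smooth_on UNIV h"
  shows "pd i (\<lambda>x. f x * h x) = (\<lambda>x. f x * pd i h x + pd i f x * h x)"
proof -
  have "((\<lambda>x. f x * h x) has_derivative
      (\<lambda>v. f x * frechet_derivative h (at x) v + frechet_derivative f (at x) v * h x)) (at x)" for x
    using assms[THEN smooth_has_derivative] by (intro derivative_intros)
  from has_derivative_pd_ex[OF this] show ?thesis by (simp add: pd_def)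
qed

lemma pd_cmult:
  fixes f :: "real^'n::finite \<Rightarrow> real"
  assumes "smooth_on UNIV f"
  shows "pd i (\<lambda>x. c * f x) = (\<lambda>x. c * pd i f x)"
  using pd_mult[OF smooth_const assms, of i c] by (simp add: pd_const)

lemma pd_add:
  fixes f h :: "real^'n::finite \<Rightarrow> real"
  assumes "smooth_on UNIV f" "smooth_on UNIV h"
  shows "pd i (\<lambda>x. f x + h x) = (\<lambda>x. pd i f x + pd i h x)"
proof -
  have "((\<lambda>x. f x + h x) has_derivative
      (\<lambda>v. frechet_derivative f (at x) v + frechet_derivative h (at x) v)) (at x)" for x
    using assms[THEN smooth_has_derivative] by (intro derivative_intros)
  from has_derivative_pd_ex[OF this] show ?thesis by (simp add: pd_def)
qed

lemma pd_chain:
  fixes f :: "real^'n::finite \<Rightarrow> real"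
  assumes "\<And>t. (F has_real_derivative F' t) (at t)" "smooth_on UNIV f"
  shows "pd i (\<lambda>x. F (f x)) = (\<lambda>x. F' (f x) * pd i f x)"
proof -
  have "((\<lambda>x. F (f x)) has_derivative (\<lambda>v. F' (f x) * frechet_derivative f (at x) v)) (at x)" for x
    using has_derivative_compose[OF smooth_has_derivative[OF assms(2)],
      of F "\<lambda>v. F' (f x) * v" x] assms(1)
    by (simp add: has_field_derivative_def)
  from has_derivative_pd_ex[OF this] show ?thesis by (simp add: pd_def)
qed

lemma pd_sum:
  fixes f :: "'i \<Rightarrow> real^'n::finite \<Rightarrow> real"
  shows "(\<And>j. j \<in> I \<Longrightarrow> smooth_on UNIV (f j)) \<Longrightarrow>
    pd i (\<lambda>x. \<Sum>j\<in>I. f j x) = (\<lambda>x. \<Sum>j\<in>I. pd i (f j) x)"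
  by (induction I rule: infinite_finite_induct) (auto simp: pd_const pd_add smooth_sum)

text \<open>The preceding closure rules are for real-valued functions, but a metric is
  matrix-valued. This shape suffices for \<open>conf_metric\<close>, a constant matrix plus a scalar
  function times another one; \<open>pd\<close> keeps the shape, with constant part 0.\<close>

lemma smooth_affine:
  fixes f :: "real^'n::finite \<Rightarrow> real" and B :: "'b::real_normed_vector"
  assumes "smooth_on UNIV f"
  shows "smooth_on UNIV (\<lambda>y. A + f y *\<^sub>R B)"
proof (rule smooth_on_coinduct)
  let ?A = "{(\<lambda>y. C + h y *\<^sub>R B) | C (h :: real^'n \<Rightarrow> real). smooth_on UNIV h}"
  show "(\<lambda>y. A + f y *\<^sub>R B) \<in> ?A" using assms by auto
  have *: "((\<lambda>y. C + h y *\<^sub>R B) has_derivative (\<lambda>v. frechet_derivative h (at x) v *\<^sub>R B)) (at x)"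
    if "smooth_on UNIV h" for h :: "real^'n \<Rightarrow> real" and C x
    using smooth_has_derivative[OF that] by (auto intro!: derivative_eq_intros)
  show "h differentiable_on UNIV" if h: "h \<in> ?A" for h
  proof -
    obtain C and k :: "real^'n \<Rightarrow> real" where "h = (\<lambda>y. C + k y *\<^sub>R B)" "smooth_on UNIV k"
      using h by blast
    then show ?thesis
      using *[of k C] by (auto simp: differentiable_on_def intro: differentiableI)
  qed
  show "pd i h \<in> ?A" if h: "h \<in> ?A" for h i
  proof -
    obtain C and k :: "real^'n \<Rightarrow> real" where k: "h = (\<lambda>y. C + k y *\<^sub>R B)" "smooth_on UNIV k"
      using h by blast
    have "pd i h = (\<lambda>y. 0 + pd i k y *\<^sub>R B)"
      unfolding k(1) has_derivative_pd_ex[OF *[OF k(2)]] by (simp add: pd_def)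
    then show ?thesis using smooth_on_pd[OF k(2)] by blast
  qed
qed

section \<open>A bump function\<close>

definition flat_exp :: "real \<Rightarrow> real" where
  "flat_exp t = (if t > 0 then exp (- 1 / t) else 0)"

lemma poly_exp_tendsto_0: "((\<lambda>s. poly P s * exp (- s)) \<longlongrightarrow> 0) at_top" for P :: "real poly"
proof -
  have *: "((\<lambda>s::real. s ^ k * exp (- s)) \<longlongrightarrow> 0) at_top" for k :: nat
    using tendsto_power_div_exp_0[of k] by (simp add: exp_minus divide_inverse)
  have "((\<lambda>s. \<Sum>i\<le>degree P. coeff P i * (s ^ i * exp (- s))) \<longlongrightarrow> (\<Sum>i\<le>degree P. coeff P i * 0)) at_top"
    by (intro tendsto_intros *)
  then show ?thesis
    by (simp add: poly_altdef sum_distrib_right mult.assoc)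
qed

text \<open>The functions P(1/t) exp(-1/t) for t > 0, extended by 0, with P a polynomial, form a
  class closed under differentiation; at 0 the exponential beats every power of 1/t.\<close>

lemma smooth_real_flat_exp: "smooth_real flat_exp"
proof -
  define D where "D P t = (if t > 0 then poly P (1 / t) * exp (- 1 / t) else (0::real))"
    for P :: "real poly" and t :: real
  \<comment> \<open>For s = 1/t one has ds/dt = - s^2, so the derivative of P(s) exp(-s) in t is s^2
    (P(s) - P'(s)) exp(-s).\<close>
  define N where "N P = [:0, 0, 1:] * (P - pderiv P)" for P :: "real poly"
  have "(D P has_real_derivative D (N P) t) (at t)" for P t
  proof (cases t "0::real" rule: linorder_cases)
    case less
    have "(D P has_real_derivative 0) (at t)"
      by (rule DERIV_cong_ev[THEN iffD2, OF refl _ refl, of _ "\<lambda>_. 0"])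
        (use eventually_nhds_in_open[of "{..<0}" t] less in \<open>auto simp: D_def elim!: eventually_mono\<close>)
    then show ?thesis using less by (simp add: D_def)
  next
    case greater
    have "((\<lambda>t. poly P (1 / t)) has_real_derivative poly (pderiv P) (1 / t) * (- 1 / t\<^sup>2)) (at t)"
      by (rule DERIV_chain2[OF poly_DERIV])
        (use greater in \<open>auto intro!: derivative_eq_intros simp: power2_eq_square\<close>)
    moreover have "((\<lambda>t. exp (- 1 / t)) has_real_derivative exp (- 1 / t) * (1 / t\<^sup>2)) (at t)"
      by (rule DERIV_chain2[OF DERIV_exp])
        (use greater in \<open>auto intro!: derivative_eq_intros simp: power2_eq_square\<close>)
    ultimately have "((\<lambda>t. poly P (1 / t) * exp (- 1 / t)) has_real_derivative
        poly (pderiv P) (1 / t) * (- 1 / t\<^sup>2) * exp (- 1 / t) +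
        exp (- 1 / t) * (1 / t\<^sup>2) * poly P (1 / t)) (at t)"
      by (rule DERIV_mult)
    also have "poly (pderiv P) (1 / t) * (- 1 / t\<^sup>2) * exp (- 1 / t) +
        exp (- 1 / t) * (1 / t\<^sup>2) * poly P (1 / t) = D (N P) t"
      using greater by (simp add: D_def N_def algebra_simps power2_eq_square)
    finally have "((\<lambda>t. poly P (1 / t) * exp (- 1 / t)) has_real_derivative D (N P) t) (at t)" .
    then show ?thesis
      by (rule DERIV_cong_ev[THEN iffD2, OF refl _ refl, rotated])
        (use eventually_nhds_in_open[of "{0<..}" t] greater in \<open>auto simp: D_def elim!: eventually_mono\<close>)
  next
    case equal
    have "((\<lambda>h. (D P h - D P 0) / h) \<longlongrightarrow> 0) (at_right 0)"
    proof -
      \<comment> \<open>\<open>pCons 0 P\<close> is P times its variable: the division by h in the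
        difference quotient is one more factor s = 1/h.\<close>
      have "((\<lambda>s. poly (pCons 0 P) s * exp (- s)) \<longlongrightarrow> 0) at_top"
        by (rule poly_exp_tendsto_0)
      then have "((\<lambda>h. poly (pCons 0 P) (inverse h) * exp (- inverse h)) \<longlongrightarrow> 0) (at_right 0)"
        by (rule filterlim_compose) (rule filterlim_inverse_at_top_right)
      then show ?thesis
        by (rule Lim_transform_eventually)
          (auto simp: eventually_at_filter D_def field_simps)
    qed
    moreover have "((\<lambda>h. (D P h - D P 0) / h) \<longlongrightarrow> 0) (at_left 0)"
      by (rule Lim_transform_eventually[of "\<lambda>_. 0"]) (auto simp: eventually_at_filter D_def)
    ultimately have "((\<lambda>h. (D P h - D P 0) / h) \<longlongrightarrow> 0) (at 0)"
      by (simp add: filterlim_split_at)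
    then show ?thesis using equal
      by (simp add: has_field_derivative_iff D_def)
  qed
  moreover have "D 1 = flat_exp"
    by (auto simp: D_def flat_exp_def)
  ultimately show ?thesis
    unfolding smooth_real_def by (intro exI[of _ "\<lambda>m. D ((N ^^ m) 1)"]) auto
qed

section \<open>Integration by parts\<close>

lemma pd_eq_0_outside:
  assumes "closed K" "\<And>y. y \<notin> K \<Longrightarrow> f y = 0" "y \<notin> K"
  shows "pd i f y = 0"
proof -
  have "(f has_derivative (\<lambda>v. 0)) (at y)"
  proof (rule has_derivative_transform_within_open)
    show "((\<lambda>y. 0) has_derivative (\<lambda>v. 0)) (at y)" by simp
    show "open (- K)" using assms by auto
  qed (use assms in auto)
  from pd_eq[OF this] show ?thesis .
qed

lemma test_fun_onE:
  assumes "test_fun_on UNIV \<phi>"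
  obtains K where "compact K" "\<And>y. y \<notin> K \<Longrightarrow> \<phi> y = 0"
  using assms by (auto simp: test_fun_on_def)

lemma test_fun_on_smooth: "test_fun_on UNIV \<phi> \<Longrightarrow> smooth_on UNIV \<phi>"
  by (simp add: test_fun_on_def)

lemma test_fun_on_pd:
  assumes "test_fun_on UNIV \<phi>"
  shows "test_fun_on UNIV (pd i \<phi>)"
proof -
  obtain K where K: "compact K" "\<And>y. y \<notin> K \<Longrightarrow> \<phi> y = 0"
    using assms test_fun_onE by blast
  then have "pd i \<phi> y = 0" if "y \<notin> K" for y
    using pd_eq_0_outside[OF compact_imp_closed] that by blast
  then show ?thesis
    using assms K(1) by (auto simp: test_fun_on_def intro: smooth_on_pd)
qed

lemma test_fun_on_mult:
  fixes f \<phi> :: "real^'n::finite \<Rightarrow> real"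
  assumes "smooth_on UNIV f" "test_fun_on UNIV \<phi>"
  shows "test_fun_on UNIV (\<lambda>y. f y * \<phi> y)"
  using assms smooth_mult[of f \<phi>] by (auto simp: test_fun_on_def)

lemma test_fun_on_bounded:
  assumes "test_fun_on UNIV \<phi>"
  obtains B where "\<And>x. \<bar>\<phi> x\<bar> \<le> B" "B \<ge> 0"
proof -
  obtain K where K: "compact K" "\<And>y. y \<notin> K \<Longrightarrow> \<phi> y = 0"
    using assms test_fun_onE by blast
  have "compact (\<phi> ` K)"
    using K(1) smooth_continuous_on[OF test_fun_on_smooth[OF assms]]
    by (intro compact_continuous_image)
  then obtain B where "\<And>z. z \<in> \<phi> ` K \<Longrightarrow> norm z \<le> B"
    using compact_imp_bounded bounded_iff by metis
  then have "\<bar>\<phi> x\<bar> \<le> max B 0" for x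
    using K(2)[of x] by (cases "x \<in> K") fastforce+
  then show thesis using that by (meson max.cobounded2)
qed

text \<open>Only restrictions of \<open>f\<close> to compact sets are known to be integrable, or
  even measurable, so \<open>f\<close> is cut off to the support of \<phi>, on which \<phi> is
  bounded.\<close>

lemma integrable_times_test_fun:
  fixes \<phi> :: "real^'n::finite \<Rightarrow> real"
  assumes "locally_integrable UNIV f" "test_fun_on UNIV \<phi>"
  shows "integrable lborel (\<lambda>x. f x * \<phi> x)"
proof -
  obtain K where K: "compact K" "\<And>y. y \<notin> K \<Longrightarrow> \<phi> y = 0"
    using assms test_fun_onE by blast
  obtain B where B: "\<And>x. \<bar>\<phi> x\<bar> \<le> B" "B \<ge> 0"
    using assms test_fun_on_bounded by blast
  have "integrable lborel (\<lambda>x. indicator K x *\<^sub>R f x)"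
    using assms(1) K(1) by (auto simp: locally_integrable_def set_integrable_def)
  then have i: "integrable lborel (\<lambda>x. B * (indicator K x *\<^sub>R f x))" by simp
  have [measurable]: "\<phi> \<in> borel_measurable borel"
    using smooth_borel_measurable[OF test_fun_on_smooth[OF assms(2)]] .
  have eq: "(\<lambda>x. f x * \<phi> x) = (\<lambda>x. (indicator K x *\<^sub>R f x) * \<phi> x)"
    using K(2) by (auto simp: fun_eq_iff indicator_def)
  show ?thesis
    unfolding eq
  proof (rule Bochner_Integration.integrable_bound[OF i])
    show "(\<lambda>x. (indicator K x *\<^sub>R f x) * \<phi> x) \<in> borel_measurable lborel"
      using \<open>integrable lborel (\<lambda>x. indicator K x *\<^sub>R f x)\<close> by (intro borel_measurable_times) auto
    show "AE x in lborel. norm (indicator K x *\<^sub>R f x * \<phi> x) \<le> norm (B * (indicator K x *\<^sub>R f x))"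
      using B by (auto simp: abs_mult mult.commute[of B] intro!: mult_left_mono)
  qed
qed

lemma continuous_locally_integrable:
  "continuous_on UNIV f \<Longrightarrow> locally_integrable UNIV f"
  unfolding locally_integrable_def set_integrable_def
  using borel_integrable_compact continuous_on_subset by blast

lemma test_fun_on_integrable:
  fixes \<phi> :: "real^'n::finite \<Rightarrow> real"
  assumes "test_fun_on UNIV \<phi>"
  shows "integrable lborel \<phi>"
  using integrable_times_test_fun[OF continuous_locally_integrable assms, of "\<lambda>_. 1"] by simp

lemma smooth_along_axis:
  fixes F :: "real^'n::finite \<Rightarrow> real"
  assumes "smooth_on UNIV F"
  shows "((\<lambda>t. F (x + t *\<^sub>R axis i 1)) has_real_derivative pd i F (x + t *\<^sub>R axis i 1)) (at t)"
proof -
  let ?D = "frechet_derivative F (at (x + t *\<^sub>R axis i 1))"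
  have "((\<lambda>t. x + t *\<^sub>R axis i 1) has_derivative (\<lambda>h. h *\<^sub>R axis i 1)) (at t)"
    by (auto intro!: derivative_eq_intros)
  from has_derivative_compose[OF this smooth_has_derivative[OF assms]]
  have "((\<lambda>t. F (x + t *\<^sub>R axis i 1)) has_derivative (\<lambda>h. ?D (h *\<^sub>R axis i 1))) (at t)" .
  moreover have "?D (h *\<^sub>R axis i 1) = pd i F (x + t *\<^sub>R axis i 1) * h" for h
    using linear_cmul[OF has_derivative_linear[OF smooth_has_derivative[OF assms]]]
    by (simp add: pd_def mult.commute)
  ultimately show ?thesis by (simp add: has_field_derivative_def)
qed

text \<open>Lebesgue measure is translation invariant, so the difference quotients of \<open>F\<close> have
  integral 0.\<close>

lemma integral_pd_eq_0:
  fixes F :: "real^'n::finite \<Rightarrow> real"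
  assumes "test_fun_on UNIV F"
  shows "(\<integral>x. pd i F x \<partial>lborel) = 0"
proof -
  note sm = test_fun_on_smooth[OF assms]
  obtain K where K: "compact K" "\<And>y. y \<notin> K \<Longrightarrow> F y = 0"
    using assms test_fun_onE by blast
  obtain B where B: "\<And>x. \<bar>pd i F x\<bar> \<le> B" "B \<ge> 0"
    using test_fun_on_bounded[OF test_fun_on_pd[OF assms]] by blast
  obtain R where R: "K \<subseteq> cball 0 R"
    using compact_imp_bounded[OF K(1)] by (auto simp: bounded_iff subset_iff)
  have [measurable]: "F \<in> borel_measurable borel" "pd i F \<in> borel_measurable borel"
    using smooth_borel_measurable sm smooth_on_pd by auto
  define e where "e = (axis i 1 :: real^'n)"
  define r where "r m = inverse (real (Suc m))" for m
  define q where "q m x = (F (x + r m *\<^sub>R e) - F x) / r m" for m x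
  have r: "0 < r m" "r m \<le> 1" for m
    by (auto simp: r_def field_simps)
  have q_le: "\<bar>q m x\<bar> \<le> B" for m x
  proof -
    have "\<exists>z. z > 0 \<and> z < r m \<and>
        F (x + r m *\<^sub>R e) - F (x + 0 *\<^sub>R e) = (r m - 0) * pd i F (x + z *\<^sub>R e)"
      unfolding e_def by (rule MVT2) (use r smooth_along_axis[OF sm] in auto)
    then obtain z where "q m x = pd i F (x + z *\<^sub>R e)"
      using r[of m] by (auto simp: q_def)
    then show ?thesis using B by simp
  qed
  \<comment> \<open>The shifts have length at most 1, so one ball of radius R + 1 contains the
    supports of all difference quotients. With \<open>q_le\<close> this gives a single dominating
    function.\<close>
  have q_0: "q m x = 0" if "x \<notin> cball 0 (R + 1)" for m x
  proof -
    have "norm (r m *\<^sub>R e) \<le> 1" using r[of m] by (simp add: e_def)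
    then have "x + r m *\<^sub>R e \<notin> K" "x \<notin> K"
      using that R norm_diff_ineq[of x "r m *\<^sub>R e"] by force+
    then show ?thesis using K(2) by (simp add: q_def)
  qed
  have "(\<lambda>m. integral\<^sup>L lborel (q m)) \<longlonglongrightarrow> integral\<^sup>L lborel (pd i F)"
  proof (rule integral_dominated_convergence)
    show "integrable lborel (\<lambda>x. indicator (cball (0 :: real^'n) (R + 1)) x *\<^sub>R B)"
      by (rule borel_integrable_compact) auto
    show "AE x in lborel. (\<lambda>m. q m x) \<longlonglongrightarrow> pd i F x"
    proof (rule AE_I2)
      fix x :: "real^'n"
      have "((\<lambda>h. (F (x + h *\<^sub>R e) - F x) / h) \<longlongrightarrow> pd i F x) (at 0)"
        using smooth_along_axis[OF sm, of x i 0] by (simp add: has_field_derivative_iff e_def)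
      moreover have "filterlim r (at 0) sequentially"
        using LIMSEQ_inverse_real_of_nat r(1) by (auto simp: filterlim_at r_def[abs_def])
      ultimately show "(\<lambda>m. q m x) \<longlonglongrightarrow> pd i F x"
        unfolding q_def by (rule filterlim_compose)
    qed
    show "AE x in lborel. norm (q m x) \<le> indicator (cball 0 (R + 1)) x *\<^sub>R B" for m
      using q_le q_0 by (intro AE_I2) (auto simp: indicator_def)
  qed (auto simp: q_def[abs_def])
  moreover have "integral\<^sup>L lborel (q m) = 0" for m
  proof -
    have iF: "integrable lborel F" by (rule test_fun_on_integrable[OF assms])
    have "integrable (distr lborel borel ((+) (r m *\<^sub>R e))) F"
      using iF by (simp add: lborel_distr_plus)
    then have i2: "integrable lborel (\<lambda>x. F (x + r m *\<^sub>R e))"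
      by (subst (asm) integrable_distr_eq) (auto simp: add.commute)
    have "(\<integral>x. F (x + r m *\<^sub>R e) \<partial>lborel) = integral\<^sup>L (distr lborel borel ((+) (r m *\<^sub>R e))) F"
      by (subst integral_distr) (auto simp: add.commute)
    then have "(\<integral>x. F (x + r m *\<^sub>R e) \<partial>lborel) = (\<integral>x. F x \<partial>lborel)"
      by (simp add: lborel_distr_plus)
    then show ?thesis
      unfolding q_def using iF i2 by simp
  qed
  ultimately show ?thesis
    by (simp add: LIMSEQ_const_iff)
qed

lemma integral_by_parts:
  fixes f \<phi> :: "real^'n::finite \<Rightarrow> real"
  assumes "smooth_on UNIV f" "test_fun_on UNIV \<phi>"
  shows "(\<integral>x. f x * pd i \<phi> x \<partial>lborel) = - (\<integral>x. pd i f x * \<phi> x \<partial>lborel)"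
proof -
  have "(\<integral>x. f x * pd i \<phi> x + pd i f x * \<phi> x \<partial>lborel) = 0"
    using integral_pd_eq_0[OF test_fun_on_mult[OF assms], of i]
    by (simp add: pd_mult[OF assms(1) test_fun_on_smooth[OF assms(2)]])
  moreover have "integrable lborel (\<lambda>x. f x * pd i \<phi> x)"
    using assms by (intro test_fun_on_integrable test_fun_on_mult test_fun_on_pd)
  moreover have "integrable lborel (\<lambda>x. pd i f x * \<phi> x)"
    using assms by (intro test_fun_on_integrable test_fun_on_mult smooth_on_pd)
  ultimately show ?thesis by simp
qed

lemma integral_by_parts_2:
  fixes f \<phi> :: "real^'n::finite \<Rightarrow> real"
  assumes "smooth_on UNIV f" "test_fun_on UNIV \<phi>"
  shows "(\<integral>x. f x * pd i (pd i \<phi>) x \<partial>lborel) = (\<integral>x. pd i (pd i f) x * \<phi> x \<partial>lborel)"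
  using integral_by_parts[OF assms(1) test_fun_on_pd[OF assms(2)], of i i]
    integral_by_parts[OF smooth_on_pd[OF assms(1)] assms(2), of i i] by simp

section \<open>Manifolds with a single global chart\<close>

text \<open>With one chart the only transition map is the identity, so every transformation law is
  trivial and \<open>chart_at\<close> has no choice left.\<close>

definition coord_riem :: "(real^'n \<Rightarrow> real^'n^'n) \<Rightarrow> (real^'n::finite, 'n) riem" where
  "coord_riem g = \<lparr>mtop = euclidean, atlas = {(UNIV, id)}, metric = (\<lambda>_. g)\<rparr>"

lemma coord_riem_simps [simp]:
  "mtop (coord_riem g) = euclidean" "atlas (coord_riem g) = {(UNIV, id)}"
  "metric (coord_riem g) c = g" "chart_at (coord_riem g) x = (UNIV, id)"
  by (auto simp: coord_riem_def chart_at_def)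

lemma global_chart_simps [simp]:
  "chart_image (UNIV, id) = UNIV" "chart_inv (UNIV, id) = id"
  "transition (UNIV, id) (UNIV, id) = id" "overlap (UNIV, id) (UNIV, id) = UNIV"
  by (auto simp: chart_image_def chart_inv_def transition_def overlap_def inv_id)

lemma pd_id: "pd i (id :: real^'n::finite \<Rightarrow> real^'n) = (\<lambda>x. axis i 1)"
  using has_derivative_pd_ex[OF has_derivative_id] by (simp add: id_def)

lemma jacobian_global_chart [simp]: "jacobian (UNIV, id) (UNIV, id) y = mat 1"
  by (simp add: jacobian_def pd_id mat_def vec_eq_iff axis_def)

lemma second_countable_euclidean:
  "second_countable (euclidean :: 'a::second_countable_topology topology)"
proof -
  obtain B :: "'a set set" where B: "countable B" "topological_basis B"
    using ex_countable_basis by blast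
  show ?thesis
    unfolding second_countable_def
  proof (intro exI[of _ B] conjI allI impI ballI)
    show "openin euclidean V" if "V \<in> B" for V
      using topological_basis_open[OF B(2) that] by simp
    show "\<exists>V\<in>B. x \<in> V \<and> V \<subseteq> U" if "openin euclidean U \<and> x \<in> U" for U x
      using topological_basisE[OF B(2), of U x] that by (metis open_openin)
  qed (rule B)
qed

lemma connected_space_euclidean:
  "connected_space (euclidean :: 'a::real_normed_vector topology)"
  using connectedin_topspace[of "euclidean :: 'a topology"] by (simp add: connected_UNIV)

lemma riemannian_manifold_coord_riem:
  fixes g :: "real^'n::finite \<Rightarrow> real^'n^'n"
  assumes "smooth_on UNIV g" "\<And>y. transpose (g y) = g y"
    and "\<And>y v. v \<noteq> 0 \<Longrightarrow> 0 < v \<bullet> (g y *v v)"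
  shows "riemannian_manifold (coord_riem g)"
proof -
  have "smooth_on UNIV (id :: real^'n \<Rightarrow> real^'n)"
  proof (rule smooth_on_coinduct)
    let ?A = "insert (id :: real^'n \<Rightarrow> real^'n) (range (\<lambda>c x. c))"
    show "id \<in> ?A" by simp
    show "h differentiable_on UNIV" if "h \<in> ?A" for h
      using that by (elim insertE rangeE) simp_all
    show "pd i h \<in> ?A" if "h \<in> ?A" for h i
      using that by (elim insertE rangeE) (simp_all add: pd_id pd_const)
  qed
  then show ?thesis
    using assms
    by (auto simp: riemannian_manifold_def smooth_atlas_def riemannian_metric_def is_chart_def
        transpose_mat Hausdorff_space_euclidean second_countable_euclidean
        connected_space_euclidean)
qed

text \<open>The \<open>THE\<close> in the definition asks for uniqueness as well as existence. The
  only chart contains every Borel set, so the formula in that chart determines the measure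
  completely.\<close>

lemma riem_measure_coord_riem:
  fixes g :: "real^'n::finite \<Rightarrow> real^'n^'n"
  assumes [measurable]: "(\<lambda>y. sqrt (det (g y))) \<in> borel_measurable borel"
  shows "riem_measure (coord_riem g) = density lborel (\<lambda>y. ennreal (sqrt (det (g y))))"
    (is "_ = ?D")
proof -
  have sets: "sigma_sets UNIV {U :: (real^'n) set. open U} = sets borel"
    by (simp add: borel_def)
  have D: "emeasure ?D B = (\<integral>\<^sup>+y\<in>B. ennreal (sqrt (det (g y))) \<partial>lborel)" if "B \<in> sets borel" for B
    using that by (simp add: emeasure_density)
  show ?thesis
    unfolding riem_measure_def
  proof (rule the_equality)
    show "space ?D = topspace (mtop (coord_riem g)) \<and>
      sets ?D = sigma_sets (topspace (mtop (coord_riem g))) {U. openin (mtop (coord_riem g)) U} \<and>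
      (\<forall>c\<in>atlas (coord_riem g). \<forall>B\<in>sets ?D. B \<subseteq> fst c \<longrightarrow> emeasure ?D B =
        (\<integral>\<^sup>+y\<in>snd c ` B. ennreal (sqrt (det (metric (coord_riem g) c y))) \<partial>lborel))"
      using D by (simp add: sets)
    show "\<mu> = ?D" if "space \<mu> = topspace (mtop (coord_riem g)) \<and>
      sets \<mu> = sigma_sets (topspace (mtop (coord_riem g))) {U. openin (mtop (coord_riem g)) U} \<and>
      (\<forall>c\<in>atlas (coord_riem g). \<forall>B\<in>sets \<mu>. B \<subseteq> fst c \<longrightarrow> emeasure \<mu> B =
        (\<integral>\<^sup>+y\<in>snd c ` B. ennreal (sqrt (det (metric (coord_riem g) c y))) \<partial>lborel))" for \<mu>
      using that D by (intro measure_eqI) (simp_all add: sets)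
  qed
qed

section \<open>Curve length, distance and completeness\<close>

text \<open>At the end points and at the break points in \<open>S\<close> nothing is known about
  \<open>vector_derivative\<close>. The indicator removes this null set; the rest is open and the
  velocity is continuous there.\<close>

lemma set_borel_measurable_norm_velocity:
  assumes "finite S" "\<gamma> C1_differentiable_on ({0<..<1} - S)"
  shows "set_borel_measurable borel {0..1} (\<lambda>t. norm (vector_derivative \<gamma> (at t)) * indicator ({0<..<1} - S) t)"
proof -
  have "open ({0<..<1::real} - S)" using assms(1) by (intro open_Diff finite_imp_closed) auto
  moreover have "continuous_on ({0<..<1} - S) (\<lambda>t. norm (vector_derivative \<gamma> (at t)))"
    using assms(2) by (intro continuous_on_norm) (simp add: C1_differentiable_on_eq)
  ultimately have "(\<lambda>t. indicator ({0<..<1} - S) t *\<^sub>R norm (vector_derivative \<gamma> (at t))) \<in> borel_measurable borel"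
    by (intro borel_measurable_continuous_on_indicator borel_open)
  then have "(\<lambda>t. norm (vector_derivative \<gamma> (at t)) * indicator ({0<..<1} - S) t) \<in> borel_measurable borel"
    by (simp add: mult.commute)
  then show ?thesis unfolding set_borel_measurable_def by measurable
qed

lemma AE_interior_unit_interval:
  fixes S :: "real set"
  assumes "finite S"
  shows "AE t in lborel. t \<in> {0..1} \<longrightarrow> t \<in> {0<..<1} - S"
proof -
  have "emeasure lborel ({0,1} \<union> S) = 0"
    using assms by (intro emeasure_lborel_countable) (auto intro: countable_finite)
  then have "AE t in lborel. t \<notin> {0,1} \<union> S"
    using assms by (intro AE_not_in) (auto simp: null_sets_def intro!: borel_closed finite_imp_closed)
  then show ?thesis by eventually_elim auto
qed

text \<open>The displacement is the integral of the velocity. The fundamental theorem yields a gauge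
  integral, the length is a nonnegative Lebesgue integral; they can be compared when the length is
  finite, and otherwise the claim is trivial.\<close>

lemma dist_le_curve_length:
  fixes \<gamma> :: "real \<Rightarrow> 'a::euclidean_space"
  assumes "finite S" "\<gamma> C1_differentiable_on ({0<..<1} - S)" "continuous_on {0..1} \<gamma>"
  shows "ennreal (dist (\<gamma> 0) (\<gamma> 1)) \<le> (\<integral>\<^sup>+t\<in>{0..1}. ennreal (norm (vector_derivative \<gamma> (at t))) \<partial>lborel)"
    (is "_ \<le> ?L")
proof (cases "?L < \<infinity>")
  case True
  let ?v = "\<lambda>t. norm (vector_derivative \<gamma> (at t)) * indicator ({0<..<1} - S) t"
  note ae = AE_interior_unit_interval[OF assms(1)]
  have L: "?L = (\<integral>\<^sup>+t\<in>{0..1}. ennreal (?v t) \<partial>lborel)"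
    by (rule nn_integral_cong_AE) (use ae in eventually_elim, auto simp: indicator_def)
  have fin: "(\<integral>\<^sup>+t\<in>{0..1}. ennreal (?v t) \<partial>lborel) < \<infinity>"
    using True L by simp
  have m: "set_borel_measurable borel {0..1} ?v"
    by (rule set_borel_measurable_norm_velocity[OF assms(1,2)])
  have eq: "?L = integral {0..1} ?v"
    unfolding L by (rule set_nn_integral_lborel_eq_integral[OF m _ fin]) auto
  have "set_integrable lborel {0..1} ?v"
    unfolding set_integrable_def
  proof (rule integrableI_bounded)
    show "(\<lambda>t. indicator {0..1} t *\<^sub>R ?v t) \<in> borel_measurable lborel"
      using m by (simp add: set_borel_measurable_def)
    have "(\<integral>\<^sup>+t. ennreal (norm (indicator {0..1} t *\<^sub>R ?v t)) \<partial>lborel) = (\<integral>\<^sup>+t\<in>{0..1}. ennreal (?v t) \<partial>lborel)"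
      by (rule nn_integral_cong) (auto simp: indicator_def)
    then show "(\<integral>\<^sup>+t. ennreal (norm (indicator {0..1} t *\<^sub>R ?v t)) \<partial>lborel) < \<infinity>"
      using fin by simp
  qed
  then have int: "?v integrable_on {0..1}"
    by (rule set_borel_integral_eq_integral(1))
  have "((\<lambda>t. vector_derivative \<gamma> (at t)) has_integral (\<gamma> 1 - \<gamma> 0)) {0..1}"
    using assms by (intro fundamental_theorem_of_calculus_interior_strong[of S])
      (auto simp: C1_differentiable_on_eq vector_derivative_works)
  then have i: "((\<lambda>t. indicator ({0<..<1} - S) t *\<^sub>R vector_derivative \<gamma> (at t)) has_integral (\<gamma> 1 - \<gamma> 0)) {0..1}"
    by (rule has_integral_spike_finite[of "{0,1} \<union> S", rotated 2]) (use assms(1) in \<open>auto simp: indicator_def\<close>)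
  have "norm (integral {0..1} (\<lambda>t. indicator ({0<..<1} - S) t *\<^sub>R vector_derivative \<gamma> (at t)))
      \<le> integral {0..1} ?v"
    by (rule integral_norm_bound_integral[OF has_integral_integrable[OF i] int]) auto
  then have "norm (\<gamma> 1 - \<gamma> 0) \<le> integral {0..1} ?v"
    by (simp only: integral_unique[OF i])
  then show ?thesis
    unfolding eq by (simp add: dist_norm norm_minus_commute ennreal_leI)
next
  case False
  then have "?L = \<infinity>" by (simp add: less_top[symmetric])
  then show ?thesis by simp
qed

lemma speed_coord_riem:
  "speed (coord_riem g) \<gamma> t = sqrt (vector_derivative \<gamma> (at t) \<bullet> (g (\<gamma> t) *v vector_derivative \<gamma> (at t)))"
  by (simp add: speed_def Let_def)

lemma dist_le_riem_dist:
  fixes g :: "real^'n::finite \<Rightarrow> real^'n^'n"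
  assumes "\<And>y v. (norm v)\<^sup>2 \<le> v \<bullet> (g y *v v)"
  shows "ennreal (dist x y) \<le> riem_dist (coord_riem g) x y"
  unfolding riem_dist_def
proof (rule INF_greatest)
  fix \<gamma> assume "\<gamma> \<in> {\<gamma>. piecewise_C1_curve (coord_riem g) \<gamma> \<and> \<gamma> 0 = x \<and> \<gamma> 1 = y}"
  then obtain S where S: "finite S" "\<gamma> C1_differentiable_on ({0<..<1} - S)"
    "continuous_on {0..1} \<gamma>" "\<gamma> 0 = x" "\<gamma> 1 = y"
    by (auto simp: piecewise_C1_curve_def set_diff_eq)
  have "norm v \<le> sqrt (v \<bullet> (g y *v v))" for y v
    using assms[of v y] by (rule real_le_rsqrt)
  then have "(\<integral>\<^sup>+t\<in>{0..1}. ennreal (norm (vector_derivative \<gamma> (at t))) \<partial>lborel) \<le> curve_length (coord_riem g) \<gamma>"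
    unfolding curve_length_def speed_coord_riem
    by (intro nn_integral_mono mult_right_mono ennreal_leI) auto
  with dist_le_curve_length[OF S(1-3)] show "ennreal (dist x y) \<le> curve_length (coord_riem g) \<gamma>"
    using S(4,5) order_trans by blast
qed

text \<open>The straight segment is a competitor in the infimum, with constant velocity y -
  x.\<close>

lemma riem_dist_le_dist:
  fixes g :: "real^'n::finite \<Rightarrow> real^'n^'n"
  assumes "\<And>y v. v \<bullet> (g y *v v) \<le> (C * norm v)\<^sup>2" "C \<ge> 0"
  shows "riem_dist (coord_riem g) x y \<le> ennreal (C * dist x y)"
proof -
  define \<gamma> where "\<gamma> t = x + t *\<^sub>R (y - x)" for t
  have d: "(\<gamma> has_vector_derivative (y - x)) (at t)" for t
    unfolding \<gamma>_def by (auto intro!: derivative_eq_intros)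
  then have vd: "vector_derivative \<gamma> (at t) = y - x" for t
    by (rule vector_derivative_at)
  have "\<gamma> C1_differentiable_on X" for X
    using d unfolding C1_differentiable_on_def by (intro exI[of _ "\<lambda>_. y - x"]) auto
  moreover have "continuous_on {0..1} \<gamma>"
    unfolding \<gamma>_def by (intro continuous_intros)
  ultimately have "piecewise_C1_curve (coord_riem g) \<gamma>"
    by (auto simp: piecewise_C1_curve_def)
  then have "riem_dist (coord_riem g) x y \<le> curve_length (coord_riem g) \<gamma>"
    unfolding riem_dist_def by (intro INF_lower) (auto simp: \<gamma>_def)
  also have "\<dots> \<le> (\<integral>\<^sup>+t\<in>{0..1::real}. ennreal (C * dist x y) \<partial>lborel)"
    unfolding curve_length_def speed_coord_riem vd
    using assms(1)[of "y - x"] assms(2)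
    by (intro nn_integral_mono mult_right_mono ennreal_leI real_le_lsqrt)
      (auto simp: dist_norm norm_minus_commute[of x y])
  also have "\<dots> = ennreal (C * dist x y)"
    by (simp add: nn_integral_cmult_indicator)
  finally show ?thesis .
qed

text \<open>By \<open>lower\<close> a Riemannian Cauchy sequence is Euclidean Cauchy and therefore
  has a Euclidean limit; by \<open>upper\<close> it converges to that limit in the Riemannian
  distance too.\<close>

lemma riem_complete_coord_riem:
  fixes g :: "real^'n::finite \<Rightarrow> real^'n^'n"
  assumes lower: "\<And>y v. (norm v)\<^sup>2 \<le> v \<bullet> (g y *v v)"
    and upper: "\<And>y v. v \<bullet> (g y *v v) \<le> (C * norm v)\<^sup>2" "C \<ge> 0"
  shows "riem_complete (coord_riem g)"
  unfolding riem_complete_def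
proof (intro allI impI, elim conjE)
  fix \<sigma> :: "nat \<Rightarrow> real^'n"
  assume c: "\<forall>e>0. \<exists>N. \<forall>m\<ge>N. \<forall>n\<ge>N. riem_dist (coord_riem g) (\<sigma> m) (\<sigma> n) < ennreal e"
  have "Cauchy \<sigma>"
  proof (rule metric_CauchyI)
    fix e :: real assume "e > 0"
    then obtain N where "\<forall>m\<ge>N. \<forall>n\<ge>N. riem_dist (coord_riem g) (\<sigma> m) (\<sigma> n) < ennreal e"
      using c by blast
    then have "\<forall>m\<ge>N. \<forall>n\<ge>N. ennreal (dist (\<sigma> m) (\<sigma> n)) < ennreal e"
      using le_less_trans[OF dist_le_riem_dist[where g = g, OF lower]] by meson
    then show "\<exists>N. \<forall>m\<ge>N. \<forall>n\<ge>N. dist (\<sigma> m) (\<sigma> n) < e"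
      using \<open>e > 0\<close> by (auto simp: ennreal_less_iff)
  qed
  obtain x where x: "\<sigma> \<longlonglongrightarrow> x"
    by (rule exE[OF convergentD[OF Cauchy_convergent[OF \<open>Cauchy \<sigma>\<close>]]])
  then have "(\<lambda>n. dist (\<sigma> n) x) \<longlonglongrightarrow> 0"
    by (rule tendsto_dist_iff[THEN iffD1])
  then have "(\<lambda>n. ennreal (C * dist (\<sigma> n) x)) \<longlonglongrightarrow> ennreal (C * 0)"
    by (rule tendsto_ennrealI[OF tendsto_mult_left])
  then have lim: "(\<lambda>n. ennreal (C * dist (\<sigma> n) x)) \<longlonglongrightarrow> 0" by simp
  have "(\<lambda>n. riem_dist (coord_riem g) (\<sigma> n) x) \<longlonglongrightarrow> 0"
  proof (rule tendsto_sandwich[OF _ _ tendsto_const lim])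
    show "\<forall>\<^sub>F n in sequentially. riem_dist (coord_riem g) (\<sigma> n) x \<le> ennreal (C * dist (\<sigma> n) x)"
      by (rule always_eventually) (intro allI riem_dist_le_dist[OF upper])
  qed simp
  then show "\<exists>x\<in>topspace (mtop (coord_riem g)). (\<lambda>n. riem_dist (coord_riem g) (\<sigma> n) x) \<longlonglongrightarrow> 0"
    by auto
qed

lemma not_compact_space_euclidean: "\<not> compact_space (euclidean :: (real^'n::finite) topology)"
  using not_compact_UNIV by (simp add: compact_space_def)

section \<open>Diagonal metrics\<close>

definition diag_mat :: "('n::finite \<Rightarrow> real) \<Rightarrow> real^'n^'n" where
  "diag_mat d = (\<chi> i j. if i = j then d i else 0)"

lemma diag_mat_nth [simp]: "diag_mat d $ i $ j = (if i = j then d i else 0)"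
  by (simp add: diag_mat_def)

lemma transpose_diag_mat: "transpose (diag_mat d) = diag_mat d"
  by (simp add: transpose_def vec_eq_iff)

lemma det_diag_mat: "det (diag_mat d) = prod d UNIV"
  by (subst det_diagonal) auto

lemma diag_mat_mult: "diag_mat d ** diag_mat e = diag_mat (\<lambda>i. d i * e i)"
proof -
  have "(\<Sum>k\<in>UNIV. diag_mat d $ i $ k * diag_mat e $ k $ j) =
      (\<Sum>k\<in>UNIV. if k = i then diag_mat (\<lambda>i. d i * e i) $ i $ j else 0)" for i j
    by (intro sum.cong) auto
  then show ?thesis
    unfolding matrix_matrix_mult_def vec_eq_iff by simp
qed

text \<open>\<open>matrix_inv\<close> is defined by choice, so its value at a concrete matrix is
  only accessible through uniqueness of inverses.\<close>

lemma matrix_inv_unique: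
  fixes A B :: "real^'n::finite^'n"
  assumes "A ** B = mat 1" "B ** A = mat 1"
  shows "matrix_inv A = B"
proof -
  have "A ** matrix_inv A = mat 1 \<and> matrix_inv A ** A = mat 1"
    unfolding matrix_inv_def by (rule someI[of _ B]) (simp add: assms)
  then have "matrix_inv A ** (A ** B) = B"
    by (simp only: matrix_mul_assoc matrix_mul_lid)
  then show ?thesis
    by (simp only: assms matrix_mul_rid)
qed

lemma matrix_inv_diag_mat:
  assumes "\<And>i. d i \<noteq> 0"
  shows "matrix_inv (diag_mat d) = diag_mat (\<lambda>i. 1 / d i)"
proof (rule matrix_inv_unique)
  show "diag_mat d ** diag_mat (\<lambda>i. 1 / d i) = mat 1" "diag_mat (\<lambda>i. 1 / d i) ** diag_mat d = mat 1"
    using assms by (simp_all add: diag_mat_mult mat_def vec_eq_iff)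
qed

lemma diag_mat_quadratic_form: "v \<bullet> (diag_mat d *v v) = (\<Sum>i\<in>UNIV. d i * (v $ i)\<^sup>2)"
proof -
  have "(diag_mat d *v v) $ i = d i * v $ i" for i
  proof -
    have "(\<Sum>j\<in>UNIV. diag_mat d $ i $ j * v $ j) = (\<Sum>j\<in>UNIV. if j = i then d i * v $ i else 0)"
      by (intro sum.cong) auto
    then show ?thesis by (simp add: matrix_vector_mult_def)
  qed
  then show ?thesis
    by (simp add: inner_vec_def power2_eq_square algebra_simps)
qed

lemma norm_vec_power2: "(norm v)\<^sup>2 = (\<Sum>i\<in>UNIV. (v $ i)\<^sup>2)" for v :: "real^'n::finite"
  by (simp add: norm_vec_def L2_set_def sum_nonneg)

section \<open>The conformal factor\<close>

text \<open>The sine keeps the factor bounded whatever its frequency; the summand 1 places the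
  minimum at 1, so that Riemannian lengths dominate Euclidean ones without a constant.\<close>

definition conf_real :: "real \<Rightarrow> real" where
  "conf_real s = exp (1 + sin (exp (2 * s\<^sup>2)))"

text \<open>This is the derivative of \<open>ln (conf_real s)\<close>. Christoffel symbols of a
  conformal metric depend on the factor only through this logarithmic derivative.\<close>

definition log_conf' :: "real \<Rightarrow> real" where
  "log_conf' s = cos (exp (2 * s\<^sup>2)) * (exp (2 * s\<^sup>2) * (4 * s))"

definition conf :: "'n::finite \<Rightarrow> real^'n \<Rightarrow> real" where
  "conf a y = conf_real (y $ a)"

lemma conf_bounds: "1 \<le> conf a y" "conf a y \<le> exp 2"
proof -
  have "-1 \<le> sin (exp (2 * (y $ a)\<^sup>2))" "sin (exp (2 * (y $ a)\<^sup>2)) \<le> 1" by auto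
  then show "1 \<le> conf a y" "conf a y \<le> exp 2"
    unfolding conf_def conf_real_def by (auto simp del: sin_ge_minus_one sin_le_one)
qed

lemma conf_pos: "0 < conf a y"
  using conf_bounds(1)[of a y] by linarith

lemma smooth_conf: "smooth_on UNIV (conf a)"
  unfolding conf_def conf_real_def by (intro smooth_intros)

lemma pd_conf: "pd i (conf a) = (\<lambda>y. if i = a then conf a y * log_conf' (y $ a) else 0)"
proof -
  have "(conf_real has_real_derivative conf_real t * log_conf' t) (at t)" for t
    unfolding conf_real_def log_conf'_def by (auto intro!: derivative_eq_intros)
  from pd_chain[OF this smooth_component, where 'n = 'a] show ?thesis
    by (auto simp: conf_def[abs_def] pd_component fun_eq_iff)
qed

definition weight :: "'n::finite \<Rightarrow> 'n \<Rightarrow> 'n \<Rightarrow> real^'n \<Rightarrow> real" where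
  "weight a b i y = (if i = a \<or> i = b then conf a y else 1)"

definition conf_metric :: "'n::finite \<Rightarrow> 'n \<Rightarrow> real^'n \<Rightarrow> real^'n^'n" where
  "conf_metric a b y = diag_mat (\<lambda>i. weight a b i y)"

lemma weight_bounds: "1 \<le> weight a b i y" "weight a b i y \<le> exp 2" "0 < weight a b i y"
  using conf_bounds[of a y] conf_pos[of a y] by (auto simp: weight_def)

lemma smooth_conf_metric: "smooth_on UNIV (conf_metric a b)"
proof -
  have "conf_metric a b = (\<lambda>y. diag_mat (\<lambda>i. if i = a \<or> i = b then 0 else 1) +
      conf a y *\<^sub>R diag_mat (\<lambda>i. if i = a \<or> i = b then 1 else 0))"
    by (auto simp: conf_metric_def weight_def vec_eq_iff fun_eq_iff)
  then show ?thesis using smooth_affine[OF smooth_conf] by simp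
qed

lemma conf_metric_lower: "(norm v)\<^sup>2 \<le> v \<bullet> (conf_metric a b y *v v)"
  unfolding norm_vec_power2 conf_metric_def diag_mat_quadratic_form
  using mult_right_mono[OF weight_bounds(1)[of a b _ y]] by (intro sum_mono) fastforce

lemma conf_metric_upper: "v \<bullet> (conf_metric a b y *v v) \<le> (exp 1 * norm v)\<^sup>2"
proof -
  have "v \<bullet> (conf_metric a b y *v v) \<le> (\<Sum>i\<in>UNIV. exp 2 * (v $ i)\<^sup>2)"
    unfolding conf_metric_def diag_mat_quadratic_form
    by (intro sum_mono mult_right_mono weight_bounds) simp
  also have "\<dots> = (exp 1 * norm v)\<^sup>2"
    by (simp add: power_mult_distrib norm_vec_power2 sum_distrib_left flip: exp_double)
  finally show ?thesis .
qed

text \<open>Exactly two diagonal entries equal the conformal factor, so the square root undoes the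
  square. The same factor then cancels against the inverse metric in the directions \<open>a\<close>
  and \<open>b\<close>.\<close>

lemma sqrt_det_conf_metric:
  assumes "a \<noteq> b"
  shows "sqrt (det (conf_metric a b y)) = conf a y"
proof -
  have "det (conf_metric a b y) = (\<Prod>i\<in>{a, b}. conf a y)"
    unfolding conf_metric_def det_diag_mat weight_def
    by (intro prod.mono_neutral_cong_right) auto
  also have "\<dots> = (conf a y)\<^sup>2"
    using assms by (simp add: power2_eq_square)
  finally show ?thesis
    using conf_pos[of a y] by simp
qed

lemma matrix_inv_conf_metric:
  "matrix_inv (conf_metric a b y) = diag_mat (\<lambda>i. 1 / weight a b i y)"
  unfolding conf_metric_def
  by (intro matrix_inv_diag_mat less_imp_neq[THEN not_sym] weight_bounds(3))

text \<open>For \<open>k = a\<close> the three derivatives of \<lambda> combine to +1 +1 -1 of them,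
  which divided by 2 \<lambda> is half the logarithmic derivative. For \<open>k \<noteq> a\<close>
  the off-diagonal entries vanish and \<lambda> does not depend on x_k.\<close>

lemma christoffel_conf_metric:
  "christoffel (conf_metric a b) k a a y = (if k = a then log_conf' (y $ a) / 2 else 0)"
proof -
  have e: "(\<lambda>z. conf_metric a b z $ a $ l) = (if l = a then conf a else (\<lambda>z. 0))" for l
    by (auto simp: conf_metric_def weight_def fun_eq_iff)
  have "christoffel (conf_metric a b) k a a y = (1/2) * (\<Sum>l\<in>UNIV. if k = l then
      1 / weight a b k y * (pd a (\<lambda>z. conf_metric a b z $ a $ k) y +
        pd a (\<lambda>z. conf_metric a b z $ a $ k) y - pd k (\<lambda>z. conf_metric a b z $ a $ a) y) else 0)"
    unfolding christoffel_def matrix_inv_conf_metric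
    by (intro arg_cong2[of _ _ _ _ "(*)"] sum.cong) auto
  also have "\<dots> = 1 / weight a b k y * (pd a (\<lambda>z. conf_metric a b z $ a $ k) y +
        pd a (\<lambda>z. conf_metric a b z $ a $ k) y - pd k (\<lambda>z. conf_metric a b z $ a $ a) y) / 2"
    by simp
  also have "\<dots> = (if k = a then log_conf' (y $ a) / 2 else 0)"
    unfolding e using conf_pos[of a y]
    by (cases "k = a") (simp_all add: pd_conf pd_const weight_def)
  finally show ?thesis .
qed

text \<open>The diagonal coefficients of \<open>sqrt (det g) g\<^sup>-\<^sup>1\<close>; the point is that the \<open>i\<close>-th one
  does not depend on the \<open>i\<close>-th coordinate.\<close>

definition flux_weight :: "'n::finite \<Rightarrow> 'n \<Rightarrow> 'n \<Rightarrow> real^'n \<Rightarrow> real" where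
  "flux_weight a b i y = (if i = a \<or> i = b then 1 else conf a y)"

lemma smooth_flux_weight: "smooth_on UNIV (flux_weight a b i)"
  unfolding flux_weight_def
  by (cases "i = a \<or> i = b") (simp_all add: smooth_const smooth_conf)

lemma pd_flux_weight: "pd i (flux_weight a b i) = (\<lambda>y. 0)"
proof (cases "i = a \<or> i = b")
  case True
  then have "flux_weight a b i = (\<lambda>y. 1)" by (auto simp: flux_weight_def)
  then show ?thesis by (simp add: pd_const)
next
  case False
  then have "flux_weight a b i = conf a" by (auto simp: flux_weight_def)
  then show ?thesis using False by (simp add: pd_conf)
qed

lemma pd_flux_weight_mult:
  assumes "smooth_on UNIV f"
  shows "pd i (\<lambda>y. flux_weight a b i y * f y) = (\<lambda>y. flux_weight a b i y * pd i f y)"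
  by (simp add: pd_mult[OF smooth_flux_weight assms] pd_flux_weight)

text \<open>In the directions \<open>a\<close> and \<open>b\<close> the volume density cancels the
  inverse metric; in the others the coefficient is \<lambda>, which is constant along that
  direction. Either way it passes through the outer derivative.\<close>

lemma laplace_coord_conf_metric:
  assumes "a \<noteq> b" "smooth_on UNIV \<phi>"
  shows "laplace_coord (conf_metric a b) \<phi> y =
    1 / conf a y * (\<Sum>i\<in>UNIV. flux_weight a b i y * pd i (pd i \<phi>) y)"
proof -
  have "sqrt (det (conf_metric a b z)) *
      (\<Sum>j\<in>UNIV. matrix_inv (conf_metric a b z) $ i $ j * pd j \<phi> z) = flux_weight a b i z * pd i \<phi> z" for i z
  proof -
    have "(\<Sum>j\<in>UNIV. matrix_inv (conf_metric a b z) $ i $ j * pd j \<phi> z) =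
        (\<Sum>j\<in>UNIV. if i = j then 1 / weight a b i z * pd i \<phi> z else 0)"
      unfolding matrix_inv_conf_metric by (intro sum.cong) auto
    then show ?thesis
      using conf_pos[of a z] by (simp add: sqrt_det_conf_metric[OF assms(1)] weight_def flux_weight_def)
  qed
  then show ?thesis
    unfolding laplace_coord_def
    by (simp add: pd_flux_weight_mult[OF smooth_on_pd[OF assms(2)]] sqrt_det_conf_metric[OF assms(1)])
qed

section \<open>The Gaussian\<close>

text \<open>The squared norm is spelled out in coordinates so that the rules for polynomials in the
  coordinates give smoothness and derivatives.\<close>

definition gauss :: "real^'n::finite \<Rightarrow> real" where
  "gauss x = exp (- (\<Sum>i\<in>UNIV. (x $ i)\<^sup>2))"

lemma gauss_norm: "gauss x = exp (- (norm x)\<^sup>2)"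
  by (simp add: gauss_def norm_vec_power2)

lemma smooth_gauss: "smooth_on UNIV gauss"
  unfolding gauss_def by (intro smooth_intros)

lemma pd_power2: "pd i (\<lambda>x :: real^'n::finite. (x $ j)\<^sup>2) = (\<lambda>x. if i = j then 2 * x $ j else 0)"
  by (simp add: power2_eq_square pd_mult[OF smooth_component smooth_component] pd_component fun_eq_iff)

lemma pd_norm_power2: "pd i (\<lambda>x :: real^'n::finite. \<Sum>j\<in>UNIV. (x $ j)\<^sup>2) = (\<lambda>x. 2 * x $ i)"
  by (subst pd_sum) (auto simp: pd_power2 intro: smooth_intros)

lemma pd_gauss: "pd i gauss = (\<lambda>x :: real^'n::finite. - 2 * x $ i * gauss x)"
proof -
  have "((\<lambda>t. exp (- t)) has_real_derivative - exp (- t)) (at t)" for t :: real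
    by (auto intro!: derivative_eq_intros)
  from pd_chain[OF this, of "\<lambda>x :: real^'n. \<Sum>j\<in>UNIV. (x $ j)\<^sup>2" i]
  have "pd i (\<lambda>x :: real^'n. exp (- (\<Sum>j\<in>UNIV. (x $ j)\<^sup>2))) =
      (\<lambda>x. - exp (- (\<Sum>j\<in>UNIV. (x $ j)\<^sup>2)) * (2 * x $ i))"
    by (simp add: smooth_intros pd_norm_power2)
  then show ?thesis by (simp add: gauss_def[abs_def] fun_eq_iff)
qed

lemma pd_pd_gauss: "pd i (pd i gauss) = (\<lambda>x :: real^'n::finite. (4 * (x $ i)\<^sup>2 - 2) * gauss x)"
proof -
  have "pd i (\<lambda>x :: real^'n. - 2 * x $ i) = (\<lambda>x. - 2)"
    by (subst pd_cmult) (auto simp: smooth_component pd_component)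
  then show ?thesis
    unfolding pd_gauss
    by (subst pd_mult) (auto simp: smooth_gauss smooth_intros pd_gauss fun_eq_iff power2_eq_square algebra_simps
      intro!: smooth_cmult[OF smooth_component])
qed

text \<open>The exponent is half that of \<open>gauss\<close>: the slack absorbs the quadratic
  factors of second derivatives, and the function is a product of multiples of standard normal
  densities.\<close>

lemma integrable_gaussian:
  "integrable lborel (\<lambda>x :: real^'n::finite. exp (- ((norm x)\<^sup>2 / 2)))"
proof -
  have "integrable lborel (\<lambda>t. sqrt (2 * pi) * normal_density 0 1 t)"
    by (intro integrable_mult_right integrable_normal_density) auto
  then have "integrable lborel (\<lambda>t::real. exp (- (t\<^sup>2 / 2)))"
    by (simp add: normal_density_def)
  then have fin: "(\<integral>\<^sup>+t. ennreal (exp (- (t\<^sup>2 / 2))) \<partial>lborel) < \<infinity>"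
    by (auto simp: integrable_iff_bounded)
  have "exp (- ((norm x)\<^sup>2 / 2)) = (\<Prod>b\<in>Basis. exp (- ((x \<bullet> b)\<^sup>2 / 2)))" for x :: "real^'n"
  proof -
    have "(norm x)\<^sup>2 = (\<Sum>b\<in>Basis. (x \<bullet> b)\<^sup>2)"
      unfolding power2_norm_eq_inner euclidean_inner[of x x] by (simp add: power2_eq_square)
    then show ?thesis
      by (simp add: exp_sum[symmetric] sum_divide_distrib sum_negf)
  qed
  then have "(\<integral>\<^sup>+x. ennreal (exp (- ((norm (x :: real^'n))\<^sup>2 / 2))) \<partial>lborel) =
      (\<integral>\<^sup>+x. (\<Prod>b\<in>Basis. ennreal (exp (- (((x :: real^'n) \<bullet> b)\<^sup>2 / 2)))) \<partial>lborel)"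
    by (simp add: prod_ennreal)
  also have "\<dots> = (\<Prod>b\<in>(Basis :: (real^'n) set). (\<integral>\<^sup>+t. ennreal (exp (- (t\<^sup>2 / 2))) \<partial>lborel))"
    by (rule nn_integral_lborel_prod) auto
  also have "\<dots> < \<infinity>"
    using fin by (auto simp: power_less_top_ennreal)
  finally show ?thesis
    by (intro integrableI_bounded) auto
qed

section \<open>Integrability of the Gaussian and of its Laplacian\<close>

lemma conf_measure:
  assumes "a \<noteq> b"
  shows "riem_measure (coord_riem (conf_metric a b)) = density lborel (\<lambda>y. ennreal (conf a y))"
proof -
  have "(\<lambda>y. sqrt (det (conf_metric a b y))) \<in> borel_measurable borel"
    using smooth_borel_measurable[OF smooth_conf[of a]] by (simp add: sqrt_det_conf_metric[OF assms])
  from riem_measure_coord_riem[OF this] show ?thesis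
    by (simp add: sqrt_det_conf_metric[OF assms])
qed

lemma measurable_conf [measurable]: "conf a \<in> borel_measurable borel"
  by (rule smooth_borel_measurable[OF smooth_conf])

text \<open>The Gaussian is at most 1, so for \<open>1 \<le> p\<close> its p-th power is no larger
  than itself, and the density \<open>conf a\<close> costs at most the factor
  \<open>exp 2\<close>.\<close>

lemma Lp_of_gaussian_bound:
  assumes "a \<noteq> b" "1 \<le> p" and h [measurable]: "h \<in> borel_measurable borel"
    and bound: "\<And>x. \<bar>h x\<bar> \<le> C * exp (- ((norm x)\<^sup>2 / 2))" and "0 \<le> C"
  shows "h \<in> Lp p (coord_riem (conf_metric a b))"
proof -
  have "integrable lborel (\<lambda>x. conf a x * \<bar>h x\<bar> powr p)"
  proof (rule Bochner_Integration.integrable_bound)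
    show "integrable lborel (\<lambda>x :: real^'a. exp 2 * C powr p * exp (- ((norm x)\<^sup>2 / 2)))"
      by (intro integrable_mult_right integrable_gaussian)
    show "AE x in lborel. norm (conf a x * \<bar>h x\<bar> powr p) \<le>
        norm (exp 2 * C powr p * exp (- ((norm x)\<^sup>2 / 2)))"
    proof (rule AE_I2)
      fix x :: "real^'a"
      have "\<bar>h x\<bar> powr p \<le> (C * exp (- ((norm x)\<^sup>2 / 2))) powr p"
        using bound assms(2) by (intro powr_mono2) auto
      also have "\<dots> = C powr p * exp (p * - ((norm x)\<^sup>2 / 2))"
        using \<open>0 \<le> C\<close> by (simp add: powr_mult exp_powr_real mult.commute)
      also have "\<dots> \<le> C powr p * exp (- ((norm x)\<^sup>2 / 2))"
        using assms(2) mult_right_mono[of 1 p "(norm x)\<^sup>2 / 2"] by (intro mult_left_mono) auto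
      finally have "conf a x * \<bar>h x\<bar> powr p \<le> exp 2 * (C powr p * exp (- ((norm x)\<^sup>2 / 2)))"
        using conf_bounds(2)[of a x] conf_pos[of a x] by (intro mult_mono) auto
      then show "norm (conf a x * \<bar>h x\<bar> powr p) \<le> norm (exp 2 * C powr p * exp (- ((norm x)\<^sup>2 / 2)))"
        using conf_pos[of a x] by (simp add: abs_mult)
    qed
  qed simp
  then show ?thesis
    using conf_pos[of a] unfolding Lp_def conf_measure[OF assms(1)]
    by (auto simp: integrable_density less_imp_le)
qed

lemma test_fun_coord_riem:
  "test_fun (coord_riem g) \<phi> \<longleftrightarrow> test_fun_on UNIV \<phi>"
  by (auto simp: test_fun_def test_fun_on_def)

text \<open>This is \<open>(1 - \<Delta>) gauss\<close>.\<close>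

definition gauss_rhs :: "'n::finite \<Rightarrow> 'n \<Rightarrow> real^'n \<Rightarrow> real" where
  "gauss_rhs a b x = gauss x - 1 / conf a x * (\<Sum>i\<in>UNIV. flux_weight a b i x * pd i (pd i gauss) x)"

text \<open>The Riemannian density cancels the factor 1/\<lambda> of the Laplacian. What remains has
  the coefficients \<open>flux_weight\<close>, the i-th of which is constant in direction i, so two
  integrations by parts move both derivatives to \<open>gauss\<close> without touching them.\<close>

lemma weak_one_minus_laplace_gauss:
  assumes "a \<noteq> b"
  shows "weak_one_minus_laplace (coord_riem (conf_metric a b)) gauss (gauss_rhs a b)"
  unfolding weak_one_minus_laplace_def test_fun_coord_riem
proof (intro allI impI)
  fix \<phi> :: "real^'a \<Rightarrow> real"
  assume \<phi>: "test_fun_on UNIV \<phi>"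
  note sm = test_fun_on_smooth[OF \<phi>]
  have [measurable]: "gauss \<in> borel_measurable (borel :: (real^'a) measure)" "\<phi> \<in> borel_measurable borel"
    "\<And>i. pd i (pd i \<phi>) \<in> borel_measurable borel" "\<And>i. pd i (pd i gauss) \<in> borel_measurable (borel :: (real^'a) measure)"
    "\<And>i. flux_weight a b i \<in> borel_measurable borel"
    by (intro smooth_borel_measurable smooth_gauss sm smooth_on_pd smooth_flux_weight)+
  have L: "laplace_beltrami (coord_riem (conf_metric a b)) \<phi> x =
      1 / conf a x * (\<Sum>i\<in>UNIV. flux_weight a b i x * pd i (pd i \<phi>) x)" for x
    using laplace_coord_conf_metric[OF assms sm] by (simp add: laplace_beltrami_def)
  have pos: "conf a x > 0" "conf a x \<noteq> 0" for x
    using conf_pos[of a x] by auto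
  have 1: "integrable lborel (\<lambda>x. conf a x * gauss x * \<phi> x)"
    by (intro test_fun_on_integrable test_fun_on_mult smooth_mult smooth_conf smooth_gauss \<phi>)
  have 2: "integrable lborel (\<lambda>x. (flux_weight a b i x * gauss x) * pd i (pd i \<phi>) x)" for i
    by (intro test_fun_on_integrable test_fun_on_mult smooth_mult smooth_flux_weight smooth_gauss test_fun_on_pd \<phi>)
  have 3: "integrable lborel (\<lambda>x. (flux_weight a b i x * pd i (pd i gauss) x) * \<phi> x)" for i
    by (intro test_fun_on_integrable test_fun_on_mult smooth_mult smooth_flux_weight smooth_gauss smooth_on_pd \<phi>)
  have 4: "(\<integral>x. (flux_weight a b i x * gauss x) * pd i (pd i \<phi>) x \<partial>lborel) =
      (\<integral>x. (flux_weight a b i x * pd i (pd i gauss) x) * \<phi> x \<partial>lborel)" for i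
    using integral_by_parts_2[OF smooth_mult[OF smooth_flux_weight smooth_gauss] \<phi>, of a b i i]
    by (simp add: pd_flux_weight_mult smooth_gauss smooth_on_pd)
  have "(\<integral>x. gauss x * (\<phi> x - laplace_beltrami (coord_riem (conf_metric a b)) \<phi> x)
        \<partial>riem_measure (coord_riem (conf_metric a b))) =
      (\<integral>x. conf a x * (gauss x * (\<phi> x - 1 / conf a x * (\<Sum>i\<in>UNIV. flux_weight a b i x * pd i (pd i \<phi>) x))) \<partial>lborel)"
    unfolding conf_measure[OF assms] L
    by (subst integral_density) (auto simp: less_imp_le[OF pos(1)])
  also have "\<dots> = (\<integral>x. conf a x * gauss x * \<phi> x - (\<Sum>i\<in>UNIV. (flux_weight a b i x * gauss x) * pd i (pd i \<phi>) x) \<partial>lborel)"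
    using pos(2) by (intro Bochner_Integration.integral_cong)
      (simp_all add: right_diff_distrib sum_distrib_left mult_ac)
  also have "\<dots> = (\<integral>x. conf a x * gauss x * \<phi> x \<partial>lborel) -
      (\<Sum>i\<in>UNIV. \<integral>x. (flux_weight a b i x * gauss x) * pd i (pd i \<phi>) x \<partial>lborel)"
    using 1 2 by (simp add: Bochner_Integration.integral_sum)
  also have "\<dots> = (\<integral>x. conf a x * gauss x * \<phi> x \<partial>lborel) -
      (\<Sum>i\<in>UNIV. \<integral>x. (flux_weight a b i x * pd i (pd i gauss) x) * \<phi> x \<partial>lborel)"
    by (simp only: 4)
  also have "\<dots> = (\<integral>x. conf a x * gauss x * \<phi> x - (\<Sum>i\<in>UNIV. (flux_weight a b i x * pd i (pd i gauss) x) * \<phi> x) \<partial>lborel)"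
    using 1 3 by (simp add: Bochner_Integration.integral_sum)
  also have "\<dots> = (\<integral>x. conf a x * (gauss_rhs a b x * \<phi> x) \<partial>lborel)"
    using pos(2) by (intro Bochner_Integration.integral_cong)
      (simp_all add: gauss_rhs_def right_diff_distrib left_diff_distrib sum_distrib_left sum_distrib_right mult_ac)
  also have "\<dots> = (\<integral>x. gauss_rhs a b x * \<phi> x \<partial>riem_measure (coord_riem (conf_metric a b)))"
    unfolding conf_measure[OF assms] gauss_rhs_def
    by (subst integral_density) (auto simp: less_imp_le[OF pos(1)])
  finally show "(\<integral>x. gauss x * (\<phi> x - laplace_beltrami (coord_riem (conf_metric a b)) \<phi> x)
        \<partial>riem_measure (coord_riem (conf_metric a b))) =
      (\<integral>x. gauss_rhs a b x * \<phi> x \<partial>riem_measure (coord_riem (conf_metric a b)))" .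
qed

lemma gauss_mem_H2p:
  assumes "a \<noteq> b" "1 \<le> p"
  shows "gauss \<in> H2p p (coord_riem (conf_metric a b))"
proof -
  have m: "gauss \<in> borel_measurable (borel :: (real^'a) measure)"
    by (intro smooth_borel_measurable smooth_gauss)
  have [measurable]: "\<And>i. pd i (pd i gauss) \<in> borel_measurable (borel :: (real^'a) measure)"
    "\<And>i. flux_weight a b i \<in> borel_measurable borel"
    by (intro smooth_borel_measurable smooth_gauss smooth_on_pd smooth_flux_weight)+
  have m2: "gauss_rhs a b \<in> borel_measurable borel"
    unfolding gauss_rhs_def using m by measurable
  have g: "gauss x \<le> exp (- ((norm x)\<^sup>2 / 2))" for x :: "real^'a"
    by (simp add: gauss_norm)
  have d: "\<bar>pd i (pd i gauss) x\<bar> \<le> 10 * exp (- ((norm x)\<^sup>2 / 2))" for i and x :: "real^'a"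
  proof -
    let ?e = "exp (- ((norm x)\<^sup>2 / 2))"
    have "gauss x = ?e * ?e"
      by (simp add: gauss_norm flip: exp_add)
    have "(x $ i)\<^sup>2 \<le> (norm x)\<^sup>2"
      using component_le_norm_cart[of x i] abs_le_square_iff[of "x $ i" "norm x"] by simp
    then have "\<bar>4 * (x $ i)\<^sup>2 - 2\<bar> \<le> 4 * (norm x)\<^sup>2 + 2" by (simp add: abs_le_iff)
    then have "\<bar>pd i (pd i gauss) x\<bar> \<le> (4 * (norm x)\<^sup>2 + 2) * ?e * ?e"
      unfolding pd_pd_gauss by (simp add: abs_mult \<open>gauss x = ?e * ?e\<close>)
    also have "\<dots> \<le> 10 * ?e"
    proof (rule mult_right_mono)
      \<comment> \<open>The constant 10 is 8 + 2: the quadratic term is 8 times the left side of the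
        first estimate, the additive 2 is twice that of the second.\<close>
      have "(norm x)\<^sup>2 / 2 \<le> exp ((norm x)\<^sup>2 / 2)" "1 \<le> exp ((norm x)\<^sup>2 / 2)"
        using exp_ge_add_one_self[of "(norm x)\<^sup>2 / 2"] by (auto simp del: exp_ge_add_one_self)
      then have "4 * (norm x)\<^sup>2 + 2 \<le> 10 * exp ((norm x)\<^sup>2 / 2)" by linarith
      then show "(4 * (norm x)\<^sup>2 + 2) * ?e \<le> 10"
        by (simp add: exp_minus field_simps)
    qed simp
    finally show ?thesis .
  qed
  have f: "\<bar>gauss_rhs a b x\<bar> \<le> (1 + real CARD('a) * 10) * exp (- ((norm x)\<^sup>2 / 2))" for x :: "real^'a"
  proof -
    let ?e = "exp (- ((norm x)\<^sup>2 / 2))"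
    have "\<bar>1 / conf a x * (\<Sum>i\<in>UNIV. flux_weight a b i x * pd i (pd i gauss) x)\<bar>
        = \<bar>\<Sum>i\<in>UNIV. (flux_weight a b i x / conf a x) * pd i (pd i gauss) x\<bar>"
      by (simp add: sum_distrib_left)
    also have "\<dots> \<le> (\<Sum>i\<in>UNIV. \<bar>(flux_weight a b i x / conf a x) * pd i (pd i gauss) x\<bar>)"
      by (rule sum_abs)
    also have "\<dots> \<le> (\<Sum>i\<in>(UNIV :: 'a set). 10 * ?e)"
    proof (rule sum_mono)
      fix i
      \<comment> \<open>The quotient is 1 / \<lambda> in the directions \<open>a\<close> and
        \<open>b\<close> and 1 in the others, so each coordinate contributes at most 10 times the
        Gaussian bound.\<close>
      have "\<bar>flux_weight a b i x / conf a x\<bar> \<le> 1"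
        using conf_bounds(1)[of a x] by (auto simp: flux_weight_def)
      then have "\<bar>flux_weight a b i x / conf a x\<bar> * \<bar>pd i (pd i gauss) x\<bar> \<le> 1 * (10 * ?e)"
        by (rule mult_mono) (auto intro: d)
      then show "\<bar>(flux_weight a b i x / conf a x) * pd i (pd i gauss) x\<bar> \<le> 10 * ?e"
        by (simp only: abs_mult mult_1)
    qed
    finally have "\<bar>1 / conf a x * (\<Sum>i\<in>UNIV. flux_weight a b i x * pd i (pd i gauss) x)\<bar>
        \<le> real CARD('a) * 10 * ?e" by simp
    moreover have "\<bar>gauss x\<bar> \<le> ?e"
      using g[of x] by (simp add: gauss_norm)
    ultimately show ?thesis
      unfolding gauss_rhs_def distrib_right mult_1
      by (intro order_trans[OF abs_triangle_ineq4] add_mono)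
  qed
  have "gauss \<in> Lp p (coord_riem (conf_metric a b))"
    using g by (intro Lp_of_gaussian_bound[where C = 1] m assms) (auto simp: gauss_norm)
  moreover have "gauss_rhs a b \<in> Lp p (coord_riem (conf_metric a b))"
    by (intro Lp_of_gaussian_bound[OF assms m2 f]) auto
  ultimately show ?thesis
    unfolding H2p_def using weak_one_minus_laplace_gauss[OF assms(1)] by auto
qed

section \<open>Oscillating test functions\<close>

lemma has_derivative_translate:
  fixes f :: "real^'n::finite \<Rightarrow> real"
  assumes "smooth_on UNIV f"
  shows "((\<lambda>x. f (x - c)) has_derivative frechet_derivative f (at (x - c))) (at x)"
proof -
  have "((\<lambda>x. x - c) has_derivative (\<lambda>v. v)) (at x)"
    by (auto intro!: derivative_eq_intros)
  from has_derivative_compose[OF this smooth_has_derivative[OF assms]] show ?thesis .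
qed

lemma pd_translate:
  fixes f :: "real^'n::finite \<Rightarrow> real"
  assumes "smooth_on UNIV f"
  shows "pd i (\<lambda>x. f (x - c)) = (\<lambda>x. pd i f (x - c))"
  using has_derivative_pd_ex[OF has_derivative_translate[OF assms]] by (simp add: pd_def)

lemma smooth_translate:
  fixes f :: "real^'n::finite \<Rightarrow> real"
  assumes "smooth_on UNIV f"
  shows "smooth_on UNIV (\<lambda>x. f (x - c))"
proof (rule smooth_on_coinduct)
  let ?A = "{(\<lambda>x. h (x - c)) | h :: real^'n \<Rightarrow> real. smooth_on UNIV h}"
  show "(\<lambda>x. f (x - c)) \<in> ?A" using assms by blast
  show "h differentiable_on UNIV" if "h \<in> ?A" for h
    using that by (auto simp: differentiable_on_def intro: differentiableI has_derivative_translate)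
  show "pd i h \<in> ?A" if "h \<in> ?A" for h i
    using that smooth_on_pd by (fastforce simp: pd_translate)
qed

lemma integral_translate:
  fixes f :: "real^'n::finite \<Rightarrow> real"
  assumes [measurable]: "f \<in> borel_measurable borel"
  shows "(\<integral>x. f (x - c) \<partial>lborel) = (\<integral>x. f x \<partial>lborel)"
proof -
  have "(\<integral>x. f x \<partial>distr lborel borel ((+) (- c))) = (\<integral>x. f (- c + x) \<partial>lborel)"
    by (rule integral_distr) auto
  then show ?thesis by (simp add: lborel_distr_plus)
qed

definition bump :: "real^'n::finite \<Rightarrow> real" where
  "bump x = flat_exp (1 - (\<Sum>i\<in>UNIV. (x $ i)\<^sup>2))"

lemma bump_norm: "bump x = flat_exp (1 - (norm x)\<^sup>2)"
  by (simp add: bump_def norm_vec_power2)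

lemma bump_bounds: "0 \<le> bump x" "bump x \<le> 1"
  by (auto simp: bump_def flat_exp_def)

lemma bump_eq_0: "1 \<le> norm x \<Longrightarrow> bump x = 0"
  by (simp add: bump_norm flat_exp_def not_less)

lemma smooth_bump: "smooth_on UNIV bump"
  unfolding bump_def by (intro smooth_compose[OF smooth_real_flat_exp] smooth_intros)

lemma test_fun_on_bump: "test_fun_on UNIV (\<lambda>x :: real^'n::finite. bump (x - c))"
proof -
  have "bump (x - c) = 0" if "x \<notin> cball c 1" for x :: "real^'n"
    using that by (intro bump_eq_0) (simp add: dist_norm norm_minus_commute)
  then show ?thesis
    unfolding test_fun_on_def using compact_cball[of c 1] smooth_translate[OF smooth_bump] by blast
qed

lemma integral_bump_pos: "0 < (\<integral>x. bump x \<partial>(lborel :: (real^'n::finite) measure))"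
proof -
  let ?B = "cball (0 :: real^'n) (1/2)"
  \<comment> \<open>This is the value of \<open>bump\<close> on the sphere of radius 1/2, where 1 -
    (1/2)^2 = 3/4, hence its minimum on the ball.\<close>
  let ?c = "flat_exp (3/4)"
  have c: "0 < ?c" by (simp add: flat_exp_def)
  have "0 < measure lborel ?B * ?c"
    using content_cball_pos[of "1/2" "0 :: real^'n"] c by simp
  also have "\<dots> = (\<integral>x. indicator ?B x *\<^sub>R ?c \<partial>lborel)"
    by simp
  also have "\<dots> \<le> (\<integral>x. bump x \<partial>(lborel :: (real^'n) measure))"
  proof (rule integral_mono)
    show "integrable lborel (\<lambda>x. indicator ?B x *\<^sub>R ?c)"
      by (rule borel_integrable_compact) auto
    show "integrable lborel (bump :: real^'n \<Rightarrow> real)"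
      using test_fun_on_integrable[OF test_fun_on_bump[of 0]] by simp
    fix x :: "real^'n"
    have "?c \<le> bump x" if "norm x \<le> 1/2"
    proof -
      have "(norm x)\<^sup>2 \<le> (1/2)\<^sup>2" using that by (intro power_mono) auto
      then show ?thesis
        by (simp add: bump_norm flat_exp_def power2_eq_square field_simps)
    qed
    then show "indicator ?B x *\<^sub>R ?c \<le> bump x"
      using bump_bounds(1)[of x] by (simp add: indicator_def)
  qed
  finally show ?thesis .
qed

definition shifted_bump :: "'n::finite \<Rightarrow> nat \<Rightarrow> real^'n \<Rightarrow> real" where
  "shifted_bump a k x = bump (x - real k *\<^sub>R axis a 1)"

lemma test_fun_on_shifted_bump: "test_fun_on UNIV (shifted_bump a k)"
  unfolding shifted_bump_def by (rule test_fun_on_bump)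

lemma shifted_bump_bounds: "0 \<le> shifted_bump a k x" "shifted_bump a k x \<le> 1"
  by (simp_all add: shifted_bump_def bump_bounds)

lemma shifted_bump_support:
  assumes "shifted_bump a k x \<noteq> 0"
  shows "real k - 1 < x $ a" "x $ a < real k + 1" "norm x \<le> real k + 1"
proof -
  have n: "norm (x - real k *\<^sub>R axis a 1) < 1"
    using assms bump_eq_0 by (auto simp: shifted_bump_def not_le[symmetric])
  then have "\<bar>(x - real k *\<^sub>R axis a 1) $ a\<bar> < 1"
    using component_le_norm_cart le_less_trans by blast
  then show "real k - 1 < x $ a" "x $ a < real k + 1"
    by (auto simp: axis_def)
  show "norm x \<le> real k + 1"
    using n norm_triangle_sub[of x "real k *\<^sub>R axis a 1"] by simp
qed

text \<open>Multiplied with \<open>gauss_hess\<close>, the cosine makes the leading oscillating term nonnegative and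
  the exponential cancels the Gaussian.\<close>

definition osc_test :: "'n::finite \<Rightarrow> nat \<Rightarrow> real^'n \<Rightarrow> real" where
  "osc_test a k x =
     (cos (exp (2 * (x $ a)\<^sup>2)) * exp (\<Sum>i\<in>UNIV. (x $ i)\<^sup>2)) * shifted_bump a k x"

lemma test_fun_on_osc_test: "test_fun_on UNIV (osc_test a k)"
  unfolding osc_test_def
  by (intro test_fun_on_mult test_fun_on_shifted_bump smooth_intros)

text \<open>This is the price of dividing by the Gaussian: on the support
  \<open>norm x \<le> k + 1\<close>. The bump is kept as a factor so that the bound stays
  integrable.\<close>

lemma abs_osc_test_le: "\<bar>osc_test a k x\<bar> \<le> exp ((real k + 1)\<^sup>2) * shifted_bump a k x"
proof (cases "shifted_bump a k x = 0")
  case False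
  have "(norm x)\<^sup>2 \<le> (real k + 1)\<^sup>2"
    using shifted_bump_support(3)[OF False] by (intro power_mono) auto
  then have "\<bar>cos (exp (2 * (x $ a)\<^sup>2))\<bar> * exp ((norm x)\<^sup>2) \<le> 1 * exp ((real k + 1)\<^sup>2)"
    by (intro mult_mono) auto
  then show ?thesis
    using mult_right_mono[OF _ shifted_bump_bounds(1)[of a k x]] shifted_bump_bounds(1)[of a k x]
    by (simp add: osc_test_def abs_mult norm_vec_power2)
qed (simp add: osc_test_def)

text \<open>The component \<open>(\<nabla>\<^sup>2 gauss)\<^sub>a\<^sub>a\<close> of the Hessian with respect to \<open>conf_metric a b\<close>.\<close>

definition gauss_hess :: "'n::finite \<Rightarrow> real^'n \<Rightarrow> real" where
  "gauss_hess a x = (4 * (x $ a)\<^sup>2 - 2 + x $ a * log_conf' (x $ a)) * gauss x"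

lemma smooth_log_conf': "smooth_on UNIV (\<lambda>x. log_conf' (x $ a))"
  unfolding log_conf'_def by (intro smooth_intros)

lemma smooth_gauss_hess: "smooth_on UNIV (gauss_hess a)"
  unfolding gauss_hess_def
  by (intro smooth_intros smooth_log_conf' smooth_gauss)

text \<open>With \<open>\<theta> = exp (2 s\<^sup>2)\<close> the oscillating part of the integrand is at least
  \<open>\<theta>' cos\<^sup>2 \<theta> = \<theta>'/2 + (sin (2 \<theta>) / 4)'\<close>, and integration by parts moves the
  derivative in the last term to the bump function.\<close>

lemma integral_gauss_hess_osc_test_ge:
  fixes a :: "'n::finite"
  assumes "2 \<le> k"
  shows "(2 * exp (2 * (real k - 1)\<^sup>2) - (4 * (real k + 1)\<^sup>2 + 2)) *
      (\<integral>x. bump x \<partial>(lborel :: (real^'n) measure))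
      - (\<integral>x. \<bar>pd a bump x\<bar> \<partial>lborel) / 4
    \<le> (\<integral>x. gauss_hess a x * osc_test a k x \<partial>lborel)"
proof -
  \<comment> \<open>On the support of the bump, \<open>E\<close> bounds \<theta> from below and
    \<open>D\<close> bounds the non-oscillating coefficient 4 x_a^2 - 2 in absolute value.\<close>
  define E where "E = exp (2 * (real k - 1)\<^sup>2)"
  define D where "D = 4 * (real k + 1)\<^sup>2 + 2"
  define \<theta> where "\<theta> x = exp (2 * (x $ a)\<^sup>2)" for x :: "real^'n"
  define S where "S x = sin (2 * \<theta> x) / 4" for x
  have smS: "smooth_on UNIV S"
    unfolding S_def \<theta>_def divide_inverse by (intro smooth_intros)
  have pdS: "pd a S = (\<lambda>x. cos (2 * \<theta> x) * (\<theta> x * (4 * x $ a)) / 2)"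
  proof -
    have "((\<lambda>s. sin (2 * exp (2 * s\<^sup>2)) / 4) has_real_derivative
        cos (2 * exp (2 * s\<^sup>2)) * (exp (2 * s\<^sup>2) * (4 * s)) / 2) (at s)" for s
      by (auto intro!: derivative_eq_intros)
    from pd_chain[OF this smooth_component[of UNIV a], of a] show ?thesis
      by (simp add: S_def[abs_def] \<theta>_def pd_component fun_eq_iff)
  qed
  let ?\<chi> = "shifted_bump a k"
  note \<chi> = test_fun_on_shifted_bump[of a k]
  have [measurable]: "bump \<in> borel_measurable (borel :: (real^'n) measure)"
    "pd a bump \<in> borel_measurable (borel :: (real^'n) measure)"
    by (intro smooth_borel_measurable smooth_bump smooth_on_pd)+
  have int\<chi>: "(\<integral>x. ?\<chi> x \<partial>lborel) = (\<integral>x. bump x \<partial>(lborel :: (real^'n) measure))"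
    unfolding shifted_bump_def by (rule integral_translate) measurable
  have pd\<chi>: "pd a ?\<chi> = (\<lambda>x. pd a bump (x - real k *\<^sub>R axis a 1))"
    unfolding shifted_bump_def[abs_def] by (rule pd_translate[OF smooth_bump])
  have i1: "integrable lborel (\<lambda>x. (2 * E - D) * ?\<chi> x)"
    by (intro integrable_mult_right test_fun_on_integrable \<chi>)
  have i2: "integrable lborel (\<lambda>x. pd a S x * ?\<chi> x)"
    by (intro test_fun_on_integrable test_fun_on_mult smooth_on_pd smS \<chi>)
  \<comment> \<open>The derivative of \<open>S\<close> is huge, but \<open>S\<close> itself is at
    most 1/4. Once the derivative sits on the bump, the error is independent of k by translation
    invariance.\<close>
  have "(\<integral>x. S x * pd a ?\<chi> x \<partial>lborel) \<le> (\<integral>x. \<bar>pd a ?\<chi> x\<bar> / 4 \<partial>lborel)"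
  proof (rule integral_mono)
    show "integrable lborel (\<lambda>x. S x * pd a ?\<chi> x)"
      by (intro test_fun_on_integrable test_fun_on_mult smS test_fun_on_pd \<chi>)
    show "integrable lborel (\<lambda>x. \<bar>pd a ?\<chi> x\<bar> / 4)"
      using test_fun_on_integrable[OF test_fun_on_pd[OF \<chi>]] by simp
    fix x
    have "S x * pd a ?\<chi> x \<le> \<bar>S x\<bar> * \<bar>pd a ?\<chi> x\<bar>"
      by (metis abs_ge_self abs_mult)
    also have "\<dots> \<le> 1/4 * \<bar>pd a ?\<chi> x\<bar>"
      by (intro mult_right_mono) (auto simp: S_def)
    finally show "S x * pd a ?\<chi> x \<le> \<bar>pd a ?\<chi> x\<bar> / 4" by simp
  qed
  also have "(\<integral>x. \<bar>pd a ?\<chi> x\<bar> / 4 \<partial>lborel) = (\<integral>x. \<bar>pd a bump x\<bar> \<partial>(lborel :: (real^'n) measure)) / 4"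
    unfolding pd\<chi> using integral_translate[of "\<lambda>x. \<bar>pd a bump x\<bar> / 4" "real k *\<^sub>R axis a 1"] by simp
  finally have "- ((\<integral>x. \<bar>pd a bump x\<bar> \<partial>(lborel :: (real^'n) measure)) / 4) \<le> (\<integral>x. pd a S x * ?\<chi> x \<partial>lborel)"
    using integral_by_parts[OF smS \<chi>, of a] by linarith
  then have "(2 * E - D) * (\<integral>x. bump x \<partial>(lborel :: (real^'n) measure)) - (\<integral>x. \<bar>pd a bump x\<bar> \<partial>(lborel :: (real^'n) measure)) / 4
      \<le> (\<integral>x. (2 * E - D) * ?\<chi> x + pd a S x * ?\<chi> x \<partial>lborel)"
    using i1 i2 int\<chi> by simp
  also have "\<dots> \<le> (\<integral>x. gauss_hess a x * osc_test a k x \<partial>lborel)"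
  proof (rule integral_mono)
    show "integrable lborel (\<lambda>x. (2 * E - D) * ?\<chi> x + pd a S x * ?\<chi> x)"
      using i1 i2 by (rule Bochner_Integration.integrable_add)
    show "integrable lborel (\<lambda>x. gauss_hess a x * osc_test a k x)"
      by (intro test_fun_on_integrable test_fun_on_mult test_fun_on_osc_test smooth_gauss_hess)
    fix x
    show "(2 * E - D) * ?\<chi> x + pd a S x * ?\<chi> x \<le> gauss_hess a x * osc_test a k x"
    proof (cases "?\<chi> x = 0")
      case False
      define s where "s = x $ a"
      define c where "c = cos (\<theta> x)"
      \<comment> \<open>The hypothesis \<open>2 \<le> k\<close> is what makes \<open>s\<close> at
        least 1; it allows factors \<open>s\<close> to be dropped from lower bounds.\<close>
      have s: "1 \<le> s" "real k - 1 < s" "s < real k + 1"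
        using shifted_bump_support[OF False] assms by (auto simp: s_def)
      have c: "-1 \<le> c" "c \<le> 1" by (auto simp: c_def)
      have E: "E \<le> \<theta> x"
        unfolding E_def \<theta>_def s_def[symmetric] using s assms by (auto intro!: power_mono)
      have \<theta>: "0 < \<theta> x" by (simp add: \<theta>_def)
      have g: "gauss x * exp (\<Sum>i\<in>UNIV. (x $ i)\<^sup>2) = 1"
        by (simp add: gauss_def flip: exp_add)
      have "gauss_hess a x * osc_test a k x =
          (4 * s\<^sup>2 - 2 + s * (c * (\<theta> x * (4 * s)))) * c * ?\<chi> x * (gauss x * exp (\<Sum>i\<in>UNIV. (x $ i)\<^sup>2))"
        by (simp add: gauss_hess_def osc_test_def log_conf'_def s_def c_def \<theta>_def)
      then have eq: "gauss_hess a x * osc_test a k x =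
          ((4 * s\<^sup>2 - 2) * c + s * (\<theta> x * (4 * s) * c\<^sup>2)) * ?\<chi> x"
        unfolding g by (simp add: algebra_simps power2_eq_square)
      have "s\<^sup>2 \<le> (real k + 1)\<^sup>2"
        using s by (intro power_mono) auto
      then have "\<bar>4 * s\<^sup>2 - 2\<bar> \<le> D"
        using zero_le_power2[of s] by (simp add: D_def abs_le_iff)
      then have "\<bar>(4 * s\<^sup>2 - 2) * c\<bar> \<le> D * 1"
        unfolding abs_mult using c by (intro mult_mono) auto
      then have 1: "- D \<le> (4 * s\<^sup>2 - 2) * c" by linarith
      have "1 * (\<theta> x * (4 * s) * c\<^sup>2) \<le> s * (\<theta> x * (4 * s) * c\<^sup>2)"
        using s \<theta> by (intro mult_right_mono) auto
      \<comment> \<open>The double angle formula splits cos^2 \<theta> into its mean 1/2, which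
        yields the main term 2 \<theta> s, and an oscillation that is exactly the derivative of
        \<open>S\<close>.\<close>
      moreover have "pd a S x = (2 * c\<^sup>2 - 1) * (\<theta> x * (4 * s)) / 2"
        by (simp add: pdS c_def cos_double_cos s_def)
      then have "\<theta> x * (4 * s) * c\<^sup>2 = 2 * \<theta> x * s + pd a S x"
        by (simp add: algebra_simps)
      moreover have "E * 1 \<le> \<theta> x * s"
        using E s \<theta> by (intro mult_mono) auto
      ultimately have "2 * E + pd a S x \<le> s * (\<theta> x * (4 * s) * c\<^sup>2)"
        by linarith
      with 1 have "(2 * E - D) + pd a S x \<le> (4 * s\<^sup>2 - 2) * c + s * (\<theta> x * (4 * s) * c\<^sup>2)"
        by linarith
      from mult_right_mono[OF this shifted_bump_bounds(1)[of a k x]] show ?thesis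
        unfolding eq by (simp add: distrib_right)
    qed (simp add: osc_test_def)
  qed
  finally show ?thesis by (simp add: E_def D_def)
qed

section \<open>The Gaussian is not in the Sobolev space\<close>

text \<open>Nothing identifies \<open>\<omega>\<close> and \<open>h\<close> pointwise, but
  eliminating \<open>\<omega>\<close> between their two weak equations shows that the
  \<open>aa\<close>-component acts on test functions like the classical Hessian. The equation for
  this component involves no component of \<open>\<omega>\<close> but the one at \<open>a\<close>,
  as the other Christoffel symbols vanish.\<close>

lemma weak_hessian_gauss:
  assumes grad: "weak_gradient (coord_riem (conf_metric a b)) gauss \<omega>"
    and cov: "weak_covariant_derivative (coord_riem (conf_metric a b)) \<omega> h"
    and \<phi>: "test_fun_on UNIV \<phi>"
  shows "integrable lborel (\<lambda>x. h (UNIV, id) x $ a $ a * \<phi> x)"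
    and "(\<integral>x. h (UNIV, id) x $ a $ a * \<phi> x \<partial>lborel) = (\<integral>x. gauss_hess a x * \<phi> x \<partial>lborel)"
proof -
  let ?w = "\<lambda>x. \<omega> (UNIV, id) x $ a"
  let ?h = "\<lambda>x. h (UNIV, id) x $ a $ a"
  let ?G = "\<lambda>x. log_conf' (x $ a) * (1/2)"
  have smG: "smooth_on UNIV ?G"
    by (intro smooth_intros smooth_log_conf')
  have \<Gamma>: "(\<Sum>k\<in>UNIV. christoffel (conf_metric a b) k a a y * \<omega> (UNIV, id) y $ k) = ?G y * ?w y" for y
  proof -
    have "(\<Sum>k\<in>UNIV. christoffel (conf_metric a b) k a a y * \<omega> (UNIV, id) y $ k) =
        (\<Sum>k\<in>UNIV. if k = a then ?G y * ?w y else 0)"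
      by (intro sum.cong) (auto simp: christoffel_conf_metric)
    then show ?thesis by simp
  qed
  have "weak_pd UNIV a ?w
      (\<lambda>y. ?h y + (\<Sum>k\<in>UNIV. christoffel (conf_metric a b) k a a y * \<omega> (UNIV, id) y $ k))"
    using cov by (simp add: weak_covariant_derivative_def)
  then have cov': "weak_pd UNIV a ?w (\<lambda>y. ?h y + ?G y * ?w y)"
    by (simp only: \<Gamma>)
  have grad': "weak_pd UNIV a gauss ?w"
    using grad by (auto simp: weak_gradient_def)
  have w: "locally_integrable UNIV ?w" and r: "locally_integrable UNIV (\<lambda>y. ?h y + ?G y * ?w y)"
    using cov' by (auto simp: weak_pd_def)
  note G\<phi> = test_fun_on_mult[OF smG \<phi>]
  have i1: "integrable lborel (\<lambda>x. (?h x + ?G x * ?w x) * \<phi> x)"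
    by (rule integrable_times_test_fun[OF r \<phi>])
  have i2: "integrable lborel (\<lambda>x. ?w x * (?G x * \<phi> x))"
    by (rule integrable_times_test_fun[OF w G\<phi>])
  \<comment> \<open>The weak equation asserts local integrability of the sum with the Christoffel
    term, not of \<open>?h\<close> alone; hence \<open>?h\<close> is recovered as a
    difference.\<close>
  have eq: "(\<lambda>x. ?h x * \<phi> x) = (\<lambda>x. (?h x + ?G x * ?w x) * \<phi> x - ?w x * (?G x * \<phi> x))"
    by (auto simp: fun_eq_iff algebra_simps)
  show "integrable lborel (\<lambda>x. ?h x * \<phi> x)"
    unfolding eq using i1 i2 by (rule Bochner_Integration.integrable_diff)
  have 1: "(\<integral>x. ?w x * pd a \<phi> x \<partial>lborel) = - (\<integral>x. (?h x + ?G x * ?w x) * \<phi> x \<partial>lborel)"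
    using cov' \<phi> by (auto simp: weak_pd_def set_lebesgue_integral_def)
  \<comment> \<open>Two choices of \<psi> remove \<open>?w\<close>: the derivative of \<phi> for the
    second-order term and \<open>?G\<close> times \<phi> for the Christoffel term.\<close>
  have 2: "(\<integral>x. gauss x * pd a \<psi> x \<partial>lborel) = - (\<integral>x. ?w x * \<psi> x \<partial>lborel)"
    if "test_fun_on UNIV \<psi>" for \<psi>
    using grad' that by (auto simp: weak_pd_def set_lebesgue_integral_def)
  have "(\<integral>x. ?h x * \<phi> x \<partial>lborel) =
      (\<integral>x. (?h x + ?G x * ?w x) * \<phi> x \<partial>lborel) - (\<integral>x. ?w x * (?G x * \<phi> x) \<partial>lborel)"
    unfolding eq using i1 i2 by (rule Bochner_Integration.integral_diff)
  also have "\<dots> = (\<integral>x. gauss x * pd a (pd a \<phi>) x \<partial>lborel) + (\<integral>x. gauss x * pd a (\<lambda>x. ?G x * \<phi> x) x \<partial>lborel)"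
    using 1 2[OF test_fun_on_pd[OF \<phi>], of a] 2[OF G\<phi>] by linarith
  also have "\<dots> = (\<integral>x. pd a (pd a gauss) x * \<phi> x \<partial>lborel) + (\<integral>x. - (pd a gauss x * (?G x * \<phi> x)) \<partial>lborel)"
    using integral_by_parts_2[OF smooth_gauss \<phi>, of a] integral_by_parts[OF smooth_gauss G\<phi>, of a]
    by simp
  also have "\<dots> = (\<integral>x. pd a (pd a gauss) x * \<phi> x + - (pd a gauss x * (?G x * \<phi> x)) \<partial>lborel)"
    by (intro Bochner_Integration.integral_add[symmetric] integrable_minus test_fun_on_integrable
        test_fun_on_mult smooth_on_pd smooth_gauss smG \<phi>)
  also have "\<dots> = (\<integral>x. gauss_hess a x * \<phi> x \<partial>lborel)"
    unfolding pd_pd_gauss unfolding pd_gauss gauss_hess_def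
    by (intro Bochner_Integration.integral_cong) (simp_all add: algebra_simps)
  finally show "(\<integral>x. ?h x * \<phi> x \<partial>lborel) = (\<integral>x. gauss_hess a x * \<phi> x \<partial>lborel)" .
qed

text \<open>The inverse metric is diagonal, so the squared norm is a sum of nonnegative terms h_ij^2
  / (w_i w_j), of which only the one at \<open>a\<close>, \<open>a\<close> is kept. The constant
  bounds the weight w_a.\<close>

lemma abs_component_le_tensor2_norm:
  "\<bar>h (UNIV, id) x $ a $ a\<bar> \<le> exp 2 * tensor2_norm (coord_riem (conf_metric a b)) h x"
proof -
  let ?H = "h (UNIV, id) x"
  let ?w = "\<lambda>i. weight a b i x"
  have "(\<Sum>k\<in>UNIV. \<Sum>l\<in>UNIV. diag_mat (\<lambda>i. 1 / ?w i) $ i $ k * diag_mat (\<lambda>i. 1 / ?w i) $ j $ l * ?H $ i $ j * ?H $ k $ l)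
      = (?H $ i $ j)\<^sup>2 / (?w i * ?w j)" for i j
  proof -
    have "(\<Sum>k\<in>UNIV. \<Sum>l\<in>UNIV. diag_mat (\<lambda>i. 1 / ?w i) $ i $ k * diag_mat (\<lambda>i. 1 / ?w i) $ j $ l * ?H $ i $ j * ?H $ k $ l)
        = (\<Sum>k\<in>UNIV. \<Sum>l\<in>UNIV. if l = j then if k = i then (?H $ i $ j)\<^sup>2 / (?w i * ?w j) else 0 else 0)"
      by (intro sum.cong) (auto simp: power2_eq_square)
    then show ?thesis by simp
  qed
  then have n: "tensor2_norm (coord_riem (conf_metric a b)) h x =
      sqrt (\<Sum>i\<in>UNIV. \<Sum>j\<in>UNIV. (?H $ i $ j)\<^sup>2 / (?w i * ?w j))"
    by (simp only: tensor2_norm_def Let_def coord_riem_simps matrix_inv_conf_metric snd_conv id_apply)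
  have nn: "0 \<le> (?H $ i $ j)\<^sup>2 / (?w i * ?w j)" for i j
    using weight_bounds(3)[of a b i x] weight_bounds(3)[of a b j x] by simp
  have "(?H $ a $ a)\<^sup>2 / (?w a * ?w a) \<le> (\<Sum>j\<in>UNIV. (?H $ a $ j)\<^sup>2 / (?w a * ?w j))"
    by (rule member_le_sum[of a UNIV "\<lambda>j. (?H $ a $ j)\<^sup>2 / (?w a * ?w j)"]) (use nn in auto)
  also have "\<dots> \<le> (\<Sum>i\<in>UNIV. \<Sum>j\<in>UNIV. (?H $ i $ j)\<^sup>2 / (?w i * ?w j))"
    by (rule member_le_sum[of a UNIV "\<lambda>i. \<Sum>j\<in>UNIV. (?H $ i $ j)\<^sup>2 / (?w i * ?w j)"])
      (use nn in \<open>auto intro: sum_nonneg\<close>)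
  finally have "sqrt ((?H $ a $ a / ?w a)\<^sup>2) \<le> tensor2_norm (coord_riem (conf_metric a b)) h x"
    unfolding n by (intro real_sqrt_le_mono) (simp add: power_divide power2_eq_square[of "?w a"])
  then have "\<bar>?H $ a $ a\<bar> / ?w a \<le> tensor2_norm (coord_riem (conf_metric a b)) h x"
    using weight_bounds(3)[of a b a x] by (simp add: abs_divide)
  then have le: "\<bar>?H $ a $ a\<bar> \<le> ?w a * tensor2_norm (coord_riem (conf_metric a b)) h x"
    using weight_bounds(3)[of a b a x] by (simp add: field_simps)
  also have "\<dots> \<le> exp 2 * tensor2_norm (coord_riem (conf_metric a b)) h x"
  proof (rule mult_right_mono[OF weight_bounds(2)])
    show "0 \<le> tensor2_norm (coord_riem (conf_metric a b)) h x"
      unfolding n using nn by (auto intro!: sum_nonneg)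
  qed
  finally show ?thesis .
qed

text \<open>This replaces Hoelder's inequality, uniformly in p: against a bump the constant 1 is
  integrable, and the power is integrable by membership in \<open>Lp\<close>.\<close>

lemma le_one_plus_powr:
  fixes t p :: real
  assumes "1 \<le> p" "0 \<le> t"
  shows "t \<le> 1 + t powr p"
proof (cases "t \<le> 1")
  case True
  then show ?thesis by (simp add: add_increasing2)
next
  case False
  then have "t powr 1 \<le> t powr p" using assms by (intro powr_mono) auto
  then show ?thesis using False by simp
qed

text \<open>One integral is bounded above by a fixed multiple of \<open>F k\<close>, of order exp
  ((k+1)^2), and below by a term of order exp (2 (k-1)^2). The quotient of the two orders is at
  least 1 + k for large k, which no constant can bound.\<close>

lemma gauss_not_mem_W2p:
  fixes a b :: "'n::finite"
  assumes "a \<noteq> b" "1 \<le> p"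
  shows "gauss \<notin> W2p p (coord_riem (conf_metric a b))"
proof
  let ?M = "coord_riem (conf_metric a b)"
  assume "gauss \<in> W2p p ?M"
  then obtain \<omega> h where grad: "weak_gradient ?M gauss \<omega>"
    and cov: "weak_covariant_derivative ?M \<omega> h" and Lp: "tensor2_norm ?M h \<in> Lp p ?M"
    by (auto simp: W2p_def)
  define N where "N = tensor2_norm ?M h"
  have [measurable]: "N \<in> borel_measurable borel"
    using Lp by (simp add: Lp_def conf_measure[OF assms(1)] N_def)
  have "integrable (density lborel (\<lambda>y. ennreal (conf a y))) (\<lambda>x. \<bar>N x\<bar> powr p)"
    using Lp by (simp add: Lp_def conf_measure[OF assms(1)] N_def)
  then have iN: "integrable lborel (\<lambda>x. conf a x * \<bar>N x\<bar> powr p)"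
    by (subst (asm) integrable_density) (auto simp: less_imp_le[OF conf_pos])
  define I where "I = (\<integral>x. conf a x * \<bar>N x\<bar> powr p \<partial>lborel)"
  define c0 where "c0 = (\<integral>x. bump x \<partial>(lborel :: (real^'n) measure))"
  define c1 where "c1 = (\<integral>x. \<bar>pd a bump x\<bar> \<partial>(lborel :: (real^'n) measure))"
  have c0: "0 < c0" unfolding c0_def by (rule integral_bump_pos)
  have c1: "0 \<le> c1" unfolding c1_def by (rule Bochner_Integration.integral_nonneg) simp
  have I: "0 \<le> I" unfolding I_def using conf_pos[of a] by (intro Bochner_Integration.integral_nonneg) (simp add: less_imp_le)
  \<comment> \<open>The first factor comes from \<open>abs_component_le_tensor2_norm\<close>, the
    second from \<open>abs_osc_test_le\<close>.\<close>
  define F where "F k = exp 2 * exp ((real k + 1)\<^sup>2)" for k :: nat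
  have upper: "(\<integral>x. gauss_hess a x * osc_test a k x \<partial>lborel) \<le> F k * (c0 + I)" for k
  proof -
    have i\<chi>: "integrable lborel (shifted_bump a k)"
      by (rule test_fun_on_integrable[OF test_fun_on_shifted_bump])
    have "(\<integral>x. gauss_hess a x * osc_test a k x \<partial>lborel) =
        (\<integral>x. h (UNIV, id) x $ a $ a * osc_test a k x \<partial>lborel)"
      by (rule weak_hessian_gauss(2)[OF grad cov test_fun_on_osc_test, symmetric])
    also have "\<dots> \<le> (\<integral>x. F k * (shifted_bump a k x + conf a x * \<bar>N x\<bar> powr p) \<partial>lborel)"
    proof (rule integral_mono)
      show "integrable lborel (\<lambda>x. h (UNIV, id) x $ a $ a * osc_test a k x)"
        by (rule weak_hessian_gauss(1)[OF grad cov test_fun_on_osc_test])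
      show "integrable lborel (\<lambda>x. F k * (shifted_bump a k x + conf a x * \<bar>N x\<bar> powr p))"
        using i\<chi> iN by simp
      fix x :: "real^'n"
      let ?\<chi> = "shifted_bump a k x"
      have "h (UNIV, id) x $ a $ a * osc_test a k x \<le> \<bar>h (UNIV, id) x $ a $ a\<bar> * \<bar>osc_test a k x\<bar>"
        by (metis abs_ge_self abs_mult)
      also have "\<dots> \<le> (exp 2 * \<bar>N x\<bar>) * (exp ((real k + 1)\<^sup>2) * ?\<chi>)"
      proof (intro mult_mono abs_osc_test_le)
        have "exp 2 * N x \<le> exp 2 * \<bar>N x\<bar>" by simp
        then show "\<bar>h (UNIV, id) x $ a $ a\<bar> \<le> exp 2 * \<bar>N x\<bar>"
          using abs_component_le_tensor2_norm[of h x a b] unfolding N_def by linarith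
      qed auto
      also have "\<dots> = F k * (?\<chi> * \<bar>N x\<bar>)" by (simp add: F_def)
      also have "\<dots> \<le> F k * (?\<chi> * (1 + \<bar>N x\<bar> powr p))"
        using shifted_bump_bounds(1)[of a k x] le_one_plus_powr[OF assms(2), of "\<bar>N x\<bar>"]
        by (intro mult_left_mono) (auto simp: F_def)
      also have "\<dots> \<le> F k * (?\<chi> + conf a x * \<bar>N x\<bar> powr p)"
      proof (rule mult_left_mono)
        \<comment> \<open>The bump is at most 1 and \<lambda> is at least 1, so the p-th power may
          be integrated over the whole space with the Riemannian density, which gives
          \<open>I\<close> for every k.\<close>
        have "?\<chi> * \<bar>N x\<bar> powr p \<le> conf a x * \<bar>N x\<bar> powr p"
          using shifted_bump_bounds(2)[of a k x] conf_bounds(1)[of a x] by (intro mult_right_mono) auto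
        then show "?\<chi> * (1 + \<bar>N x\<bar> powr p) \<le> ?\<chi> + conf a x * \<bar>N x\<bar> powr p"
          by (simp add: distrib_left)
      qed (simp add: F_def)
      finally show "h (UNIV, id) x $ a $ a * osc_test a k x \<le>
          F k * (?\<chi> + conf a x * \<bar>N x\<bar> powr p)" .
    qed
    also have "\<dots> = F k * ((\<integral>x. shifted_bump a k x \<partial>lborel) + I)"
      using i\<chi> iN by (simp add: I_def)
    also have "(\<integral>x. shifted_bump a k x \<partial>lborel) = c0"
      unfolding shifted_bump_def c0_def
      by (intro integral_translate smooth_borel_measurable smooth_bump)
    finally show ?thesis .
  qed
  \<comment> \<open>All error terms divided by \<open>F k\<close>: 6 \<open>c0\<close> from 4
    (k+1)^2 + 2 \<le> 6 \<open>F k\<close>, then \<open>c0 + I\<close> from \<open>upper\<close>,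
    and \<open>c1\<close> from the derivative of the bump.\<close>
  define C where "C = 7 * c0 + I + c1"
  have bound: "2 * c0 * (1 + real k) \<le> C" if "8 \<le> k" for k :: nat
  proof -
    have F1: "1 \<le> F k" "(real k + 1)\<^sup>2 \<le> F k"
    proof -
      have "1 + (real k + 1)\<^sup>2 \<le> exp ((real k + 1)\<^sup>2)" by (rule exp_ge_add_one_self)
      moreover have "1 * exp ((real k + 1)\<^sup>2) \<le> F k"
        unfolding F_def by (intro mult_right_mono) auto
      ultimately show "1 \<le> F k" "(real k + 1)\<^sup>2 \<le> F k"
        using zero_le_power2[of "real k + 1"] by linarith+
    qed
    \<comment> \<open>This compares the exponents of exp k times \<open>F k\<close> and of the lower
      bound. It amounts to k^2 - 7 k - 1 \<ge> 0, which holds from k = 8 on and fails at 7.\<close>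
    have "(real k + 1) + 2 + (real k + 1)\<^sup>2 \<le> 2 * (real k - 1)\<^sup>2 + 1"
    proof -
      have "8 * real k \<le> real k * real k" using that by (intro mult_right_mono) auto
      moreover have "(real k + 1)\<^sup>2 = real k * real k + 2 * real k + 1"
        "(real k - 1)\<^sup>2 = real k * real k - 2 * real k + 1"
        by (simp_all add: power2_eq_square algebra_simps)
      moreover have "8 \<le> real k" using that by simp
      ultimately show ?thesis by linarith
    qed
    then have "real k + (2 + (real k + 1)\<^sup>2) \<le> 2 * (real k - 1)\<^sup>2" by linarith
    then have "exp (real k) * F k \<le> exp (2 * (real k - 1)\<^sup>2)"
      by (simp add: F_def flip: exp_add)
    moreover have "(1 + real k) * F k \<le> exp (real k) * F k"
      using F1(1) by (intro mult_right_mono exp_ge_add_one_self) auto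
    ultimately have "(1 + real k) * F k \<le> exp (2 * (real k - 1)\<^sup>2)" by linarith
    then have "2 * ((1 + real k) * F k) - 6 * F k \<le>
        2 * exp (2 * (real k - 1)\<^sup>2) - (4 * (real k + 1)\<^sup>2 + 2)"
      using F1 by linarith
    then have "(2 * ((1 + real k) * F k) - 6 * F k) * c0 \<le>
        (2 * exp (2 * (real k - 1)\<^sup>2) - (4 * (real k + 1)\<^sup>2 + 2)) * c0"
      using c0 by (intro mult_right_mono) auto
    also have "\<dots> - c1 / 4 \<le> F k * (c0 + I)"
      using integral_gauss_hess_osc_test_ge[of k a] upper[of k] that
      unfolding c0_def c1_def by linarith
    finally have "(2 * ((1 + real k) * F k) - 6 * F k) * c0 \<le> F k * (c0 + I) + c1 / 4" by linarith
    also have "c1 / 4 \<le> F k * c1"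
      using F1(1) c1 mult_right_mono[of 1 "F k" c1] by linarith
    finally have "F k * (2 * c0 * (1 + real k)) \<le> F k * C"
      by (simp add: C_def algebra_simps)
    then show ?thesis using F1(1) by simp
  qed
  obtain m :: nat where "C / (2 * c0) < real m"
    using reals_Archimedean2 by blast
  then have "C < 2 * c0 * real m" using c0 by (simp add: field_simps)
  also have "\<dots> \<le> 2 * c0 * (1 + real (max m 8))" using c0 by simp
  also have "\<dots> \<le> C" by (rule bound) simp
  finally show False by simp
qed

theorem proposition3p1:
  fixes p :: real
  assumes "1 \<le> p" and "2 \<le> CARD('n::finite)"
  shows "\<exists>M :: (real^'n, 'n) riem.
    riemannian_manifold M \<and> riem_complete M \<and> \<not> compact_space (mtop M) \<and>
    H2p p M - W2p p M \<noteq> {}"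
proof -
  obtain a b :: 'n where ab: "a \<noteq> b"
    using assms(2) card_2_iff' by (metis (full_types) UNIV_I card_le_Suc0_iff_eq finite numeral_2_eq_2 not_less_eq_eq)
  have pos: "0 < v \<bullet> (conf_metric a b y *v v)" if "v \<noteq> 0" for v y
    using conf_metric_lower[of v a b y] that by (smt (verit) zero_less_norm_iff zero_less_power)
  show ?thesis
  proof (intro exI[of _ "coord_riem (conf_metric a b)"] conjI)
    show "riemannian_manifold (coord_riem (conf_metric a b))"
      by (rule riemannian_manifold_coord_riem[OF smooth_conf_metric _ pos])
        (simp add: conf_metric_def transpose_diag_mat)
    show "riem_complete (coord_riem (conf_metric a b))"
      by (rule riem_complete_coord_riem[OF conf_metric_lower conf_metric_upper]) simp
    show "\<not> compact_space (mtop (coord_riem (conf_metric a b)))"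
      by (simp add: not_compact_space_euclidean)
    show "H2p p (coord_riem (conf_metric a b)) - W2p p (coord_riem (conf_metric a b)) \<noteq> {}"
      using gauss_mem_H2p[OF ab assms(1)] gauss_not_mem_W2p[OF ab assms(1)] by blast
  qed
qed

end
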